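(* Let $\varphi_0$ be a constant $m\times m$ matrix with $[J,\varphi_0]=0$ that satisfies one of the reduction conditions $$\varphi_0^\dagger=\varphi_0+C\quad\text{(defocusing case)},\qquad \varphi_0^\dagger=J\varphi_0J+C\quad\text{(focusing case)},$$ where $C$ is an anti-Hermitian matrix commuting with $J$. Let $\boldsymbol{P}$ be a solution of the $n\times n$ matrix equations $$\mathrm{i}\,\boldsymbol{P}_t+\boldsymbol{P}_y\,\boldsymbol{J}\,\boldsymbol{P}=0,\qquad \boldsymbol{P}_x=\tfrac12(\boldsymbol{J}\boldsymbol{P}\boldsymbol{J}-\boldsymbol{P})\,\boldsymbol{P},$$ such that $\sigma(\boldsymbol{J}\boldsymbol{P})\cap\sigma(-\boldsymbol{P}^\dagger\boldsymbol{J})=\emptyset$ (at every point). Let $\boldsymbol{X}$ be the unique solution of the Lyapunov equation $$\boldsymbol{X}\,(\boldsymbol{J}\boldsymbol{P})+(\boldsymbol{J}\boldsymbol{P})^\dagger\,\boldsymbol{X}=\boldsymbol{V}_0\,\boldsymbol{U}_0,$$ where $\boldsymbol{U}_0$ is a constant $m\times n$ matrix with $J\boldsymbol{U}_0=\boldsymbol{U}_0\boldsymbol{J}$, and $$\boldsymbol{V}_0=\boldsymbol{U}_0^\dagger J\ \text{ in the defocusing case},\qquad \boldsymbol{V}_0=\boldsymbol{U}_0^\dagger\ \text{ in the focusing case}.$$ Then the blocks $q,u,v$ read off from $$\varphi=\begin{pmatrix}u&q\\ r&v\end{pmatrix}=\varphi_0+J\,\boldsymbol{U}_0\,\boldsymbol{X}^{-1}\,\boldsymbol{V}_0$$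 solve (wherever $\boldsymbol{X}$ is invertible) the matrix $(2+1)$-dimensional NLS system $$-\mathrm{i}\,q_t=q_{xy}+q\,v_y+u_y\,q,\qquad u_x=\mp q\,q^\dagger,\qquad v_x=\mp q^\dagger q,$$ with the upper sign in the defocusing and the lower sign in the focusing case. If $m_1=m_2=1$, then $q$ solves the $(2+1)$-dimensional NLS equation $$\mathrm{i}\,q_t+q_{xy}\mp2\,q\,\Big(\int^x|q|^2\,dx\Big)_y=0 .$$
   Context: All matrices have entries that are smooth complex functions of real variables $x,y,t$ (on an open domain); subscripts $x,y,t$ denote partial derivatives; "constant" means independent of $x,y,t$; ${}^\dagger$ denotes Hermitian conjugation. $m=m_1+m_2$ and $J=\begin{pmatrix}I_{m_1}&0\\0&-I_{m_2}\end{pmatrix}$; $\varphi$ is decomposed into blocks accordingly, so $u$ is $m_1\times m_1$, $q$ is $m_1\times m_2$, $r$ is $m_2\times m_1$, $v$ is $m_2\times m_2$. $\boldsymbol{J}$ is an $n\times n$ counterpart of $J$: a constant diagonal matrix with entries $\pm1$ on the diagonal. $\sigma(\cdot)$ denotes the spectrum of a matrix. In the scalar equation, $\int^x|q|^2\,dx$ stands for an $x$-antiderivative of $|q|^2$; the one meant is $\mp\frac12(u+v)$, arising from the system via $u_x=v_x=\mp|q|^2$. *)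

theory Defs
  imports "HOL-Analysis.Analysis"
begin

primrec Ck_on :: "nat \<Rightarrow> 'a::real_normed_vector set \<Rightarrow> ('a \<Rightarrow> 'b::real_normed_vector) \<Rightarrow> bool" where
  "Ck_on 0 D f \<longleftrightarrow> continuous_on D f"
| "Ck_on (Suc k) D f \<longleftrightarrow>
     (\<forall>p\<in>D. f differentiable (at p)) \<and> (\<forall>v. Ck_on k D (\<lambda>p. frechet_derivative f (at p) v))"

definition smooth_on :: "'a::real_normed_vector set \<Rightarrow> ('a \<Rightarrow> 'b::real_normed_vector) \<Rightarrow> bool" where
  "smooth_on D f \<longleftrightarrow> (\<forall>k. Ck_on k D f)"

text \<open>A point of the space of independent variables is a triple \<open>(x, y, t)\<close>.\<close>

type_synonym point = "real \<times> real \<times> real"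

definition d_x :: "(point \<Rightarrow> 'b::real_normed_vector) \<Rightarrow> point \<Rightarrow> 'b" where
  "d_x f = (\<lambda>(x, y, t). vector_derivative (\<lambda>s. f (s, y, t)) (at x))"

definition d_y :: "(point \<Rightarrow> 'b::real_normed_vector) \<Rightarrow> point \<Rightarrow> 'b" where
  "d_y f = (\<lambda>(x, y, t). vector_derivative (\<lambda>s. f (x, s, t)) (at y))"

definition d_t :: "(point \<Rightarrow> 'b::real_normed_vector) \<Rightarrow> point \<Rightarrow> 'b" where
  "d_t f = (\<lambda>(x, y, t). vector_derivative (\<lambda>s. f (x, y, s)) (at t))"

text \<open>The type \<open>complex ^ 'c ^ 'r\<close> is that of matrices with rows indexed by \<open>'r\<close> and columns
  indexed by \<open>'c\<close>. The sizes \<open>m\<^sub>1\<close>, \<open>m\<^sub>2\<close>, \<open>n\<close> are the cardinalities of index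
  types \<open>'m1\<close>, \<open>'m2\<close>, \<open>'n\<close>, and a matrix of size \<open>m = m\<^sub>1 + m\<^sub>2\<close> is indexed by the sum
  type \<open>'m1 + 'm2\<close>, which carries the block decomposition. Complex multiples of a matrix
  are written \<open>mat c ** A\<close>.\<close>

definition dagger :: "complex ^ 'c ^ 'r \<Rightarrow> complex ^ 'r ^ 'c" where
  "dagger A = (\<chi> i j. cnj (A $ j $ i))"

definition spectrum :: "complex ^ 'n ^ 'n \<Rightarrow> complex set" where
  "spectrum A = {z. \<not> invertible (A - mat z)}"

definition J :: "complex ^ ('m1::finite + 'm2::finite) ^ ('m1 + 'm2)" where
  "J = (\<chi> i j. if i = j then (case i of Inl _ \<Rightarrow> 1 | Inr _ \<Rightarrow> - 1) else 0)"

definition diagonal_signs :: "complex ^ 'n ^ 'n \<Rightarrow> bool" where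
  "diagonal_signs A \<longleftrightarrow> (\<forall>i j. i \<noteq> j \<longrightarrow> A $ i $ j = 0) \<and> (\<forall>i. A $ i $ i = 1 \<or> A $ i $ i = - 1)"

definition block_u :: "complex ^ ('m1::finite + 'm2::finite) ^ ('m1 + 'm2) \<Rightarrow> complex ^ 'm1 ^ 'm1" where
  "block_u A = (\<chi> i j. A $ Inl i $ Inl j)"

definition block_q :: "complex ^ ('m1::finite + 'm2::finite) ^ ('m1 + 'm2) \<Rightarrow> complex ^ 'm2 ^ 'm1" where
  "block_q A = (\<chi> i j. A $ Inl i $ Inr j)"

definition block_v :: "complex ^ ('m1::finite + 'm2::finite) ^ ('m1 + 'm2) \<Rightarrow> complex ^ 'm2 ^ 'm2" where
  "block_v A = (\<chi> i j. A $ Inr i $ Inr j)"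

definition lyapunov :: "complex ^ 'n ^ 'n \<Rightarrow> complex ^ 'n ^ 'n \<Rightarrow> complex ^ 'n ^ 'n \<Rightarrow> bool" where
  "lyapunov A W X \<longleftrightarrow> X ** A + dagger A ** X = W"

datatype reduction = Defocusing | Focusing

text \<open>The value of the sign \<open>\<plusminus>\<close>: upper in the defocusing, lower in the focusing case.\<close>

fun pm :: "reduction \<Rightarrow> real" where
  "pm Defocusing = 1"
| "pm Focusing = - 1"

fun reduction_condition ::
  "reduction \<Rightarrow> complex ^ ('m1::finite + 'm2::finite) ^ ('m1 + 'm2) \<Rightarrow>
   complex ^ ('m1::finite + 'm2::finite) ^ ('m1 + 'm2) \<Rightarrow> bool" where
  "reduction_condition Defocusing \<phi>0 C \<longleftrightarrow> dagger \<phi>0 = \<phi>0 + C"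
| "reduction_condition Focusing \<phi>0 C \<longleftrightarrow> dagger \<phi>0 = J ** \<phi>0 ** J + C"

fun V0_of ::
  "reduction \<Rightarrow> complex ^ 'n ^ ('m1::finite + 'm2::finite) \<Rightarrow> complex ^ ('m1 + 'm2) ^ 'n" where
  "V0_of Defocusing U0 = dagger U0 ** J"
| "V0_of Focusing U0 = dagger U0"

definition solves_matrix_NLS ::
  "reduction \<Rightarrow> point set \<Rightarrow> (point \<Rightarrow> complex ^ 'm1 ^ 'm1) \<Rightarrow>
   (point \<Rightarrow> complex ^ 'm2 ^ 'm1) \<Rightarrow> (point \<Rightarrow> complex ^ 'm2 ^ 'm2) \<Rightarrow> bool" where
  "solves_matrix_NLS c D u q v \<longleftrightarrow>
     smooth_on D u \<and> smooth_on D q \<and> smooth_on D v \<and>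
     (\<forall>p\<in>D. mat (- \<i>) ** d_t q p = d_y (d_x q) p + q p ** d_y v p + d_y u p ** q p \<and>
            d_x u p = - (pm c *\<^sub>R (q p ** dagger (q p))) \<and>
            d_x v p = - (pm c *\<^sub>R (dagger (q p) ** q p)))"

text \<open>The argument \<open>w\<close> is the chosen \<open>x\<close>-antiderivative of \<open>\<bar>q\<bar>\<^sup>2\<close>.\<close>

definition solves_scalar_NLS ::
  "reduction \<Rightarrow> point set \<Rightarrow> (point \<Rightarrow> complex) \<Rightarrow> (point \<Rightarrow> complex) \<Rightarrow> bool" where
  "solves_scalar_NLS c D q w \<longleftrightarrow>
     smooth_on D q \<and> smooth_on D w \<and>
     (\<forall>p\<in>D. d_x w p = of_real ((cmod (q p))\<^sup>2) \<and>
            \<i> * d_t q p + d_y (d_x q) p - of_real (pm c) * 2 * q p * d_y w p = 0)"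

end

theory Submission
  imports Defs "HOL-Computational_Algebra.Fundamental_Theorem_Algebra"
begin

text \<open>
  Put \<open>A = \<^bold>J P\<close>, \<open>K = X\<inverse>\<close>, \<open>W = V\<^sub>0 U\<^sub>0\<close> and \<open>\<psi> = J U\<^sub>0 K V\<^sub>0\<close>; then \<open>\<^bold>J W = W \<^bold>J\<close>. Since the
  Lyapunov operator \<open>Y \<mapsto> Y A + A\<^sup>\<dagger> Y\<close> is injective, differentiating the Lyapunov equation
  determines the derivatives of \<open>X\<close>:
  \<open>2 X\<^sub>x = W \<^bold>J - X \<^bold>J A - A\<^sup>\<dagger> \<^bold>J X\<close> and \<open>\<i> X\<^sub>t = X A\<^sub>y + A\<^sup>\<dagger> X\<^sub>y\<close>.
  With \<open>G = U\<^sub>0 A K V\<^sub>0\<close> this gives \<open>2 \<psi>\<^sub>x = G - J G J + \<psi> J \<psi> J - \<psi>\<^sup>2\<close>, whose blocks are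
  \<open>u\<^sub>x = - q r\<close>, \<open>v\<^sub>x = - r q\<close> and \<open>q\<^sub>x = G\<^sub>q - u q\<close>, while
  \<open>- \<i> K\<^sub>t = (A K)\<^sub>y - K W K\<^sub>y\<close>; comparing \<open>q\<^sub>x\<^sub>y\<close> with \<open>q\<^sub>t\<close> yields the NLS equation.
  Uniqueness for the Lyapunov equation also makes \<open>X\<close> Hermitian, hence \<open>r = \<plusminus> q\<^sup>\<dagger>\<close>.
\<close>

section \<open>Differentiability of solutions of linear equations\<close>

lemma Ck_on_SucI:
  assumes "\<And>p. p \<in> D \<Longrightarrow> (f has_derivative f' p) (at p)"
    and "\<And>v. Ck_on k D (\<lambda>p. frechet_derivative f (at p) v)"
  shows "Ck_on (Suc k) D f"
  using assms by (auto simp: differentiable_def)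

lemma Ck_on_Suc_differentiable:
  assumes "Ck_on (Suc k) D f" and "p \<in> D"
  shows "(f has_derivative frechet_derivative f (at p)) (at p)"
  using assms by (auto simp: frechet_derivative_works)

lemma Ck_on_Suc_imp: "Ck_on (Suc k) D f \<Longrightarrow> Ck_on k D f"
proof (induction k arbitrary: f)
  case 0
  then show ?case
    by (auto intro!: continuous_at_imp_continuous_on differentiable_imp_continuous_within)
next
  case (Suc k)
  have diff: "\<And>p. p \<in> D \<Longrightarrow> (f has_derivative frechet_derivative f (at p)) (at p)"
    by (rule Ck_on_Suc_differentiable[OF Suc.prems])
  have "Ck_on (Suc k) D (\<lambda>p. frechet_derivative f (at p) v)" for v
    using Suc.prems[unfolded Ck_on.simps(2)[of "Suc k"]] by (rule conjunct2[THEN spec])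
  from Ck_on_SucI[OF diff Suc.IH[OF this]] show ?case .
qed

lemma Ck_on_imp_continuous_on: "Ck_on k D f \<Longrightarrow> continuous_on D f"
proof (induction k)
  case (Suc k)
  then show ?case using Ck_on_Suc_imp by blast
qed simp

lemma Ck_on_subset: "Ck_on k D f \<Longrightarrow> E \<subseteq> D \<Longrightarrow> Ck_on k E f"
  by (induction k arbitrary: f) (auto intro: continuous_on_subset)

lemma Ck_on_cong:
  assumes "open D" and "\<And>p. p \<in> D \<Longrightarrow> f p = g p" and "Ck_on k D f"
  shows "Ck_on k D g"
  using assms(2,3)
proof (induction k arbitrary: f g)
  case 0
  then show ?case using continuous_on_cong by fastforce
next
  case (Suc k)
  have g: "(g has_derivative frechet_derivative f (at p)) (at p)" if "p \<in> D" for p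
    using has_derivative_transform_within_open[OF Ck_on_Suc_differentiable[OF Suc.prems(2) that] assms(1) that]
      Suc.prems(1) by simp
  show ?case
  proof (rule Ck_on_SucI)
    fix v
    show "Ck_on k D (\<lambda>p. frechet_derivative g (at p) v)"
    proof (rule Suc.IH)
      show "Ck_on k D (\<lambda>p. frechet_derivative f (at p) v)" using Suc.prems by simp
      show "frechet_derivative f (at p) v = frechet_derivative g (at p) v" if "p \<in> D" for p
        using frechet_derivative_at[OF g[OF that]] by simp
    qed
  qed (rule g)
qed

lemma Ck_on_Suc_has_derivative:
  assumes "open D" and "\<And>p. p \<in> D \<Longrightarrow> (f has_derivative f' p) (at p)"
    and "\<And>v. Ck_on k D (\<lambda>p. f' p v)"
  shows "Ck_on (Suc k) D f"
proof (rule Ck_on_SucI[OF assms(2)])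
  show "Ck_on k D (\<lambda>p. frechet_derivative f (at p) v)" for v
    by (rule Ck_on_cong[OF assms(1) _ assms(3)[of v]])
      (simp add: frechet_derivative_at[OF assms(2), symmetric])
qed

lemma Ck_on_const: "Ck_on k D (\<lambda>p. c)"
proof (induction k arbitrary: c)
  case (Suc k)
  then show ?case by simp
qed simp

lemma Ck_on_bounded_linear:
  assumes "open D" and "bounded_linear L" and "Ck_on k D f"
  shows "Ck_on k D (\<lambda>p. L (f p))"
  using assms(3)
proof (induction k arbitrary: f)
  case 0
  then show ?case
    by (auto intro: bounded_linear.continuous_on[OF assms(2)])
next
  case (Suc k)
  show ?case
  proof (rule Ck_on_Suc_has_derivative[OF assms(1)])
    show "((\<lambda>p. L (f p)) has_derivative (\<lambda>v. L (frechet_derivative f (at p) v))) (at p)"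
      if "p \<in> D" for p
      by (rule bounded_linear.has_derivative[OF assms(2) Ck_on_Suc_differentiable[OF Suc.prems that]])
    show "Ck_on k D (\<lambda>p. L (frechet_derivative f (at p) v))" for v
      using Suc by simp
  qed
qed

lemma Ck_on_add:
  assumes "open D" and "Ck_on k D f" and "Ck_on k D g"
  shows "Ck_on k D (\<lambda>p. f p + g p)"
  using assms(2,3)
proof (induction k arbitrary: f g)
  case 0
  then show ?case by (auto intro: continuous_on_add)
next
  case (Suc k)
  show ?case
  proof (rule Ck_on_Suc_has_derivative[OF assms(1)])
    show "((\<lambda>p. f p + g p) has_derivative
        (\<lambda>v. frechet_derivative f (at p) v + frechet_derivative g (at p) v)) (at p)"
      if "p \<in> D" for p
      using Suc.prems that by (intro has_derivative_add Ck_on_Suc_differentiable)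
    show "Ck_on k D (\<lambda>p. frechet_derivative f (at p) v + frechet_derivative g (at p) v)" for v
      using Suc by simp
  qed
qed

lemma Ck_on_bounded_bilinear:
  assumes "open D" and "bounded_bilinear B" and "Ck_on k D f" and "Ck_on k D g"
  shows "Ck_on k D (\<lambda>p. B (f p) (g p))"
  using assms(3,4)
proof (induction k arbitrary: f g)
  case 0
  then show ?case
    by (auto intro: bounded_bilinear.continuous_on[OF assms(2)])
next
  case (Suc k)
  show ?case
  proof (rule Ck_on_Suc_has_derivative[OF assms(1)])
    show "((\<lambda>p. B (f p) (g p)) has_derivative
        (\<lambda>v. B (f p) (frechet_derivative g (at p) v) + B (frechet_derivative f (at p) v) (g p))) (at p)"
      if "p \<in> D" for p
      using Suc.prems that
      by (intro bounded_bilinear.FDERIV[OF assms(2)] Ck_on_Suc_differentiable)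
    show "Ck_on k D (\<lambda>p. B (f p) (frechet_derivative g (at p) v) + B (frechet_derivative f (at p) v) (g p))" for v
      using Suc by (intro Ck_on_add[OF assms(1)] Suc.IH) (auto intro: Ck_on_Suc_imp simp del: Ck_on.simps(2) simp: Ck_on.simps(2)[of k])
  qed
qed

lemma continuous_on_bilinear_solution:
  fixes B :: "'c::euclidean_space \<Rightarrow> 'f::euclidean_space \<Rightarrow> 'g::euclidean_space"
    and D :: "'a::real_normed_vector set"
  assumes B: "bounded_bilinear B" and "open D"
    and A: "continuous_on D A" and W: "continuous_on D W"
    and inj: "\<And>p. p \<in> D \<Longrightarrow> inj (B (A p))"
    and eq: "\<And>p. p \<in> D \<Longrightarrow> B (A p) (X p) = W p"
  shows "continuous_on D X"
proof (intro continuous_at_imp_continuous_on ballI)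
  fix p assume p: "p \<in> D"
  interpret B: bounded_bilinear B by (rule B)
  have ev: "\<forall>\<^sub>F q in at p. q \<in> D"
    using eventually_at_in_open'[OF \<open>open D\<close> p] by simp
  have At: "(A \<longlongrightarrow> A p) (at p)" and Wt: "(W \<longlongrightarrow> W p) (at p)"
    using A W \<open>open D\<close> p by (simp_all add: continuous_on_eq_continuous_at continuous_within)
  obtain c where c: "c > 0" "\<And>Y. c * norm Y \<le> norm (B (A p) Y)"
    using linear_inj_bounded_below_pos[OF bounded_linear.linear[OF B.bounded_linear_right] inj[OF p]]
    by metis
  obtain M where M: "M > 0" "\<And>a b. norm (B a b) \<le> norm a * norm b * M"
    using B.pos_bounded by blast
  have "((\<lambda>q. norm (A q - A p) * M) \<longlongrightarrow> norm (A p - A p) * M) (at p)"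
    by (intro tendsto_intros At)
  from order_tendstoD(2)[OF this, of "c / 2"]
  have evA: "\<forall>\<^sub>F q in at p. norm (A q - A p) * M < c / 2"
    using c(1) by simp
  have lim: "((\<lambda>q. 2 / c * norm (W q - B (A q) (X p))) \<longlongrightarrow> 2 / c * norm (W p - B (A p) (X p))) (at p)"
    by (intro tendsto_intros At Wt B.tendsto)
  have "((\<lambda>q. X q - X p) \<longlongrightarrow> 0) (at p)"
  proof (rule Lim_null_comparison)
    show "((\<lambda>q. 2 / c * norm (W q - B (A q) (X p))) \<longlongrightarrow> 0) (at p)"
      using lim eq[OF p] by simp
    show "\<forall>\<^sub>F q in at p. norm (X q - X p) \<le> 2 / c * norm (W q - B (A q) (X p))"
      using ev evA
    proof eventually_elim
      fix q assume q: "q \<in> D" and small: "norm (A q - A p) * M < c / 2"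
      let ?Y = "X q - X p"
      have "norm (B (A q - A p) ?Y) \<le> c / 2 * norm ?Y"
        using M(2)[of "A q - A p" ?Y] mult_right_mono[OF less_imp_le[OF small] norm_ge_zero[of ?Y]]
        by (simp add: mult_ac)
      moreover have "norm (B (A p) ?Y) \<le> norm (B (A q) ?Y) + norm (B (A q - A p) ?Y)"
        using norm_triangle_ineq4[of "B (A q) ?Y" "B (A q - A p) ?Y"] by (simp add: B.diff_left)
      ultimately have "c / 2 * norm ?Y \<le> norm (B (A q) ?Y)"
        using c(2)[of ?Y] by (simp add: field_simps)
      also have "B (A q) ?Y = W q - B (A q) (X p)"
        using eq[OF q] by (simp add: B.diff_right)
      finally show "norm ?Y \<le> 2 / c * norm (W q - B (A q) (X p))"
        using c(1) by (simp add: field_simps)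
    qed
  qed
  then show "isCont X p" by (simp add: isCont_def LIM_zero_iff)
qed

text \<open>Continuity of \<open>g\<close> suffices because \<open>f\<close> vanishes at \<open>p\<close>.\<close>

lemma has_derivative_bilinear_null_left:
  assumes B: "bounded_bilinear B" and f: "(f has_derivative f') (at p)" and "f p = 0"
    and g: "isCont g p"
  shows "((\<lambda>q. B (f q) (g q)) has_derivative (\<lambda>v. B (f' v) (g p))) (at p)"
proof -
  interpret B: bounded_bilinear B by (rule B)
  obtain M where M: "M > 0" "\<And>a b. norm (B a b) \<le> norm a * norm b * M"
    using B.pos_bounded by blast
  have null: "((\<lambda>q. B (f q) (g q - g p)) has_derivative (\<lambda>v. 0)) (at p)"
    unfolding has_derivative_iff_norm
  proof (intro conjI bounded_linear_zero)
    obtain K where K: "K > 0" "\<And>v. norm (f' v) \<le> norm v * K"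
      using bounded_linear.pos_bounded[OF has_derivative_bounded_linear[OF f]] by blast
    have f0: "((\<lambda>q. norm (f q - f p - f' (q - p)) / norm (q - p)) \<longlongrightarrow> 0) (at p)"
      using f by (simp add: has_derivative_iff_norm)
    have "((\<lambda>q. (norm (f q - f p - f' (q - p)) / norm (q - p) + K) * norm (g q - g p) * M)
        \<longlongrightarrow> (0 + K) * norm (g p - g p) * M) (at p)"
      using g by (intro tendsto_intros f0) (simp add: isCont_def)
    then have lim: "((\<lambda>q. (norm (f q - f p - f' (q - p)) / norm (q - p) + K) * norm (g q - g p) * M)
        \<longlongrightarrow> 0) (at p)" by simp
    show "((\<lambda>q. norm (B (f q) (g q - g p) - B (f p) (g p - g p) - 0) / norm (q - p)) \<longlongrightarrow> 0) (at p)"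
    proof (rule Lim_null_comparison[OF _ lim])
      show "\<forall>\<^sub>F q in at p. norm (norm (B (f q) (g q - g p) - B (f p) (g p - g p) - 0) / norm (q - p))
          \<le> (norm (f q - f p - f' (q - p)) / norm (q - p) + K) * norm (g q - g p) * M"
        unfolding eventually_at_filter
      proof (rule always_eventually, intro allI impI)
        fix q assume "q \<noteq> p"
        have "norm (f q) \<le> norm (f q - f' (q - p)) + norm (q - p) * K"
          using norm_triangle_sub[of "f q" "f' (q - p)"] K(2)[of "q - p"] by linarith
        then have fq: "norm (f q) / norm (q - p) \<le> norm (f q - f p - f' (q - p)) / norm (q - p) + K"
          using \<open>q \<noteq> p\<close> \<open>f p = 0\<close> by (simp add: field_simps)
        have "norm (B (f q) (g q - g p)) / norm (q - p) \<le> norm (f q) / norm (q - p) * (norm (g q - g p) * M)"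
          using divide_right_mono[OF M(2)[of "f q" "g q - g p"], of "norm (q - p)"] by (simp add: mult_ac)
        also have "\<dots> \<le> (norm (f q - f p - f' (q - p)) / norm (q - p) + K) * (norm (g q - g p) * M)"
          using fq M(1) by (intro mult_right_mono) auto
        finally show "norm (norm (B (f q) (g q - g p) - B (f p) (g p - g p) - 0) / norm (q - p))
          \<le> (norm (f q - f p - f' (q - p)) / norm (q - p) + K) * norm (g q - g p) * M"
          by (simp add: B.zero_right mult_ac)
      qed
    qed
  qed
  have "((\<lambda>q. B (f q) (g p)) has_derivative (\<lambda>v. B (f' v) (g p))) (at p)"
    by (rule bounded_linear.has_derivative[OF B.bounded_linear_left f])
  from has_derivative_add[OF null this] show ?thesis
    by (simp add: B.diff_right)
qed

lemma differentiable_bilinear_solution: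
  fixes B :: "'c::euclidean_space \<Rightarrow> 'f::euclidean_space \<Rightarrow> 'g::euclidean_space"
    and D :: "'a::real_normed_vector set"
  assumes B: "bounded_bilinear B" and "open D"
    and A: "\<And>p. p \<in> D \<Longrightarrow> A differentiable (at p)" and W: "\<And>p. p \<in> D \<Longrightarrow> W differentiable (at p)"
    and inj: "\<And>p. p \<in> D \<Longrightarrow> inj (B (A p))"
    and eq: "\<And>p. p \<in> D \<Longrightarrow> B (A p) (X p) = W p"
    and p: "p \<in> D"
  shows "X differentiable (at p)"
proof -
  interpret B: bounded_bilinear B by (rule B)
  have "continuous_on D A" "continuous_on D W"
    using A W by (auto intro!: continuous_at_imp_continuous_on differentiable_imp_continuous_within)
  from continuous_on_bilinear_solution[OF B \<open>open D\<close> this inj eq]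
  have X: "isCont X p" using \<open>open D\<close> p by (simp add: continuous_on_eq_continuous_at)
  define A' where "A' = frechet_derivative A (at p)"
  define W' where "W' = frechet_derivative W (at p)"
  have A': "(A has_derivative A') (at p)" and W': "(W has_derivative W') (at p)"
    using A[OF p] W[OF p] by (simp_all add: A'_def W'_def frechet_derivative_works)
  have "((\<lambda>q. A q - A p) has_derivative A') (at p)"
    using has_derivative_diff[OF A' has_derivative_const] by simp
  from has_derivative_diff[OF W' has_derivative_bilinear_null_left[OF B this _ X]]
  have "((\<lambda>q. W q - B (A q - A p) (X q)) has_derivative (\<lambda>v. W' v - B (A' v) (X p))) (at p)"
    by simp
  moreover have "W q - B (A q - A p) (X q) = B (A p) (X q)" if "q \<in> D" for q
    using eq[OF that] by (simp add: B.diff_left)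
  ultimately have *: "((\<lambda>q. B (A p) (X q)) has_derivative (\<lambda>v. W' v - B (A' v) (X p))) (at p)"
    by (rule has_derivative_transform_within_open[OF _ \<open>open D\<close> p])
  obtain M where M: "linear M" "M \<circ> B (A p) = id"
    using linear_injective_left_inverse[OF bounded_linear.linear[OF B.bounded_linear_right] inj[OF p]]
    by blast
  have "bounded_linear M" using M(1) by (simp add: linear_conv_bounded_linear)
  from bounded_linear.has_derivative[OF this *] have
    "((\<lambda>q. M (B (A p) (X q))) has_derivative (\<lambda>v. M (W' v - B (A' v) (X p)))) (at p)" .
  moreover have "(\<lambda>q. M (B (A p) (X q))) = X" using M(2) by (auto simp: fun_eq_iff)
  ultimately show ?thesis by (auto simp: differentiable_def)
qed

lemma Ck_on_bilinear_solution:
  fixes B :: "'c::euclidean_space \<Rightarrow> 'f::euclidean_space \<Rightarrow> 'g::euclidean_space"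
    and D :: "'a::real_normed_vector set"
  assumes B: "bounded_bilinear B" and "open D"
    and A: "Ck_on k D A" and W: "Ck_on k D W"
    and inj: "\<And>p. p \<in> D \<Longrightarrow> inj (B (A p))"
    and eq: "\<And>p. p \<in> D \<Longrightarrow> B (A p) (X p) = W p"
  shows "Ck_on k D X"
  using A W eq
proof (induction k arbitrary: W X)
  case 0
  then show ?case using continuous_on_bilinear_solution[OF B \<open>open D\<close> _ _ inj] by simp
next
  case (Suc k)
  interpret B: bounded_bilinear B by (rule B)
  have Xk: "Ck_on k D X"
    by (rule Suc.IH[OF Ck_on_Suc_imp[OF Suc.prems(1)] Ck_on_Suc_imp[OF Suc.prems(2)] Suc.prems(3)])
  have X': "(X has_derivative frechet_derivative X (at p)) (at p)" if "p \<in> D" for p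
  proof -
    have "X differentiable (at p)"
      by (rule differentiable_bilinear_solution[OF B \<open>open D\<close> _ _ inj Suc.prems(3) that])
        (use Suc.prems in auto)
    then show ?thesis by (simp add: frechet_derivative_works)
  qed
  show ?case
  proof (rule Ck_on_SucI[OF X'])
    fix v
    show "Ck_on k D (\<lambda>p. frechet_derivative X (at p) v)"
    proof (rule Suc.IH)
      show "Ck_on k D A" using Suc.prems Ck_on_Suc_imp by blast
      show "Ck_on k D (\<lambda>p. frechet_derivative W (at p) v + - B (frechet_derivative A (at p) v) (X p))"
        using Suc.prems Xk
        by (intro Ck_on_add Ck_on_bounded_linear[OF _ bounded_linear_minus[OF bounded_linear_ident]]
             Ck_on_bounded_bilinear[OF _ B] \<open>open D\<close>) auto
      fix p assume p: "p \<in> D"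
      have "((\<lambda>p. B (A p) (X p)) has_derivative
          (\<lambda>v. B (A p) (frechet_derivative X (at p) v) + B (frechet_derivative A (at p) v) (X p))) (at p)"
        by (intro bounded_bilinear.FDERIV[OF B] X'[OF p] Ck_on_Suc_differentiable[OF Suc.prems(1) p])
      from has_derivative_unique[OF has_derivative_transform_within_open[OF this \<open>open D\<close> p Suc.prems(3)]
          Ck_on_Suc_differentiable[OF Suc.prems(2) p]]
      have "(\<lambda>v. B (A p) (frechet_derivative X (at p) v) + B (frechet_derivative A (at p) v) (X p))
          = frechet_derivative W (at p)"
        by simp
      from fun_cong[OF this, of v] show "B (A p) (frechet_derivative X (at p) v) =
          frechet_derivative W (at p) v + - B (frechet_derivative A (at p) v) (X p)"
        by (simp add: eq_diff_eq)
    qed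
  qed
qed

section \<open>Complex matrices\<close>

lemma bounded_bilinear_matrix_mult:
  "bounded_bilinear ((**) :: complex ^ 'k ^ 'n \<Rightarrow> complex ^ 'm ^ 'k \<Rightarrow> complex ^ 'm ^ 'n)"
proof -
  have "bilinear ((**) :: complex ^ 'k ^ 'n \<Rightarrow> complex ^ 'm ^ 'k \<Rightarrow> complex ^ 'm ^ 'n)"
    unfolding bilinear_def
    by (auto intro!: linearI simp: matrix_matrix_mult_def vec_eq_iff sum.distrib distrib_left
        distrib_right scaleR_sum_right)
  then show ?thesis by (simp add: bilinear_conv_bounded_bilinear)
qed

interpretation matrix_mult: bounded_bilinear
  "(**) :: complex ^ 'k ^ 'n \<Rightarrow> complex ^ 'm ^ 'k \<Rightarrow> complex ^ 'm ^ 'n"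
  by (rule bounded_bilinear_matrix_mult)

lemmas matrix_mult_distribs = matrix_mult.add_left matrix_mult.add_right
  matrix_mult.diff_left matrix_mult.diff_right matrix_mult.minus_left matrix_mult.minus_right
  matrix_mult.scaleR_left matrix_mult.scaleR_right

lemma bounded_linear_two_sided_mult: "bounded_linear (\<lambda>M. L ** M ** R)" for L R :: "complex ^ _ ^ _"
  by (rule bounded_linear_compose[OF matrix_mult.bounded_linear_left matrix_mult.bounded_linear_right])

lemma mat_mult_component [simp]: "(mat z ** A) $ i $ j = z * A $ i $ j"
  by (simp add: matrix_matrix_mult_def mat_def if_distrib if_distribR cong: if_cong)

lemma mult_mat_component [simp]: "(A ** mat z) $ i $ j = A $ i $ j * z"
  by (simp add: matrix_matrix_mult_def mat_def if_distrib if_distribR cong: if_cong)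

lemma mat_add: "mat (a + b) = mat a + (mat b :: complex ^ 'n ^ 'n)"
  by (simp add: mat_def vec_eq_iff)

lemma mat_uminus: "mat (- z) = - (mat z :: complex ^ 'n ^ 'n)"
  by (simp add: mat_def vec_eq_iff)

lemma mat_mult_commute: "mat z ** A = A ** mat (z :: complex)"
  by (simp add: vec_eq_iff)

lemma mat_mult_left_commute: "A ** (mat z ** B) = mat (z :: complex) ** (A ** B)"
  by (metis mat_mult_commute matrix_mul_assoc)

lemma mat_mult_mat_mult: "mat a ** (mat b ** A) = mat (a * b :: complex) ** A"
  by (simp add: vec_eq_iff)

lemma dagger_mult: "dagger (A ** B) = dagger B ** dagger A"
  by (simp add: dagger_def matrix_matrix_mult_def vec_eq_iff mult.commute)

lemma dagger_add: "dagger (A + B) = dagger A + dagger B"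
  by (simp add: dagger_def vec_eq_iff)

lemma dagger_diff: "dagger (A - B) = dagger A - dagger B"
  by (simp add: dagger_def vec_eq_iff)

lemma dagger_scaleR: "dagger (r *\<^sub>R A) = r *\<^sub>R dagger A"
  by (simp add: dagger_def vec_eq_iff)

lemma dagger_dagger [simp]: "dagger (dagger A) = A"
  by (simp add: dagger_def vec_eq_iff)

lemma dagger_mat: "dagger (mat z) = mat (cnj z)"
  by (auto simp: dagger_def mat_def vec_eq_iff)

lemma bounded_linear_dagger: "bounded_linear dagger"
proof -
  have "linear (dagger :: complex ^ 'c ^ 'r \<Rightarrow> _)"
    by (intro linearI dagger_add dagger_scaleR)
  then show ?thesis by (simp add: linear_conv_bounded_linear)
qed

lemma invertible_imp_two_sided:
  assumes "invertible X"
  shows "X ** matrix_inv X = mat 1" and "matrix_inv X ** X = mat 1"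
  using assms someI_ex[of "\<lambda>K. X ** K = mat 1 \<and> K ** X = mat 1"]
  by (auto simp: invertible_def matrix_inv_def)

section \<open>Sylvester and Lyapunov equations\<close>

lemma exists_linear_relation:
  fixes f :: "nat \<Rightarrow> 'a::euclidean_space"
  obtains N c k where "k \<le> N" and "c k \<noteq> 0" and "(\<Sum>i\<le>N. c i *\<^sub>R f i) = 0"
proof -
  let ?N = "DIM('a)"
  show ?thesis
  proof (cases "inj_on f {..?N}")
    case True
    then have "dependent (f ` {..?N})"
      by (intro dependent_biggerset) (simp add: card_image)
    then obtain u where "\<exists>v\<in>f ` {..?N}. u v \<noteq> 0" "(\<Sum>v\<in>f ` {..?N}. u v *\<^sub>R v) = 0"
      by (subst (asm) real_vector.dependent_finite) auto
    then show ?thesis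
      using that[of _ ?N "u \<circ> f"] True by (auto simp: sum.reindex)
  next
    case False
    then obtain i j where ij: "i \<le> ?N" "j \<le> ?N" "i \<noteq> j" "f i = f j"
      by (auto simp: inj_on_def)
    let ?c = "\<lambda>k. (if k = i then 1 else 0) - (if k = j then 1 else 0 :: real)"
    have "(\<Sum>k\<le>?N. ?c k *\<^sub>R f k) = f i - f j"
      using ij by (simp add: scaleR_left_diff_distrib sum_subtractf if_distrib[of "\<lambda>x. x *\<^sub>R _"] cong: if_cong)
    then show ?thesis using that[of i ?N ?c] ij by simp
  qed
qed

definition poly_mult :: "complex poly \<Rightarrow> complex ^ 'n ^ 'n \<Rightarrow> complex ^ 'n ^ 'm \<Rightarrow> complex ^ 'n ^ 'm" where
  "poly_mult p A Y = fold_coeffs (\<lambda>a M. mat a ** Y + M ** A) p 0"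

lemma poly_mult_0 [simp]: "poly_mult 0 A Y = 0"
  by (simp add: poly_mult_def)

lemma poly_mult_pCons [simp]: "poly_mult (pCons a p) A Y = mat a ** Y + poly_mult p A Y ** A"
  by (cases "a = 0 \<and> p = 0") (auto simp: poly_mult_def)

lemma poly_mult_add: "poly_mult (p + q) A Y = poly_mult p A Y + poly_mult q A Y"
proof (induction p arbitrary: q)
  case (pCons a p)
  show ?case
    by (cases q) (simp add: pCons.IH mat_add matrix_mult_distribs)
qed simp

lemma poly_mult_sum: "poly_mult (\<Sum>i\<in>S. p i) A Y = (\<Sum>i\<in>S. poly_mult (p i) A Y)"
  by (induction S rule: infinite_finite_induct) (simp_all add: poly_mult_add)

lemma poly_mult_monom: "poly_mult (monom a k) A Y = mat a ** ((\<lambda>M. M ** A) ^^ k) Y"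
  by (induction k) (simp_all add: monom_0 monom_Suc matrix_mul_assoc)

lemma poly_mult_smult: "poly_mult (smult c p) A Y = mat c ** poly_mult p A Y"
  by (induction p) (simp_all add: matrix_mult_distribs mat_mult_mat_mult matrix_mul_assoc[symmetric])

lemma poly_mult_linear_factor:
  "poly_mult ([:- z, 1:] * p) A Y = poly_mult p A (Y ** A - mat z ** Y)"
proof (induction p)
  case (pCons a p)
  have "[:- z, 1:] * pCons a p = smult a [:- z, 1:] + pCons 0 ([:- z, 1:] * p)"
    by simp
  then have "poly_mult ([:- z, 1:] * pCons a p) A Y
      = mat a ** poly_mult [:- z, 1:] A Y + poly_mult p A (Y ** A - mat z ** Y) ** A"
    by (simp only: poly_mult_add poly_mult_smult poly_mult_pCons pCons.IH) simp
  moreover have "poly_mult [:- z, 1:] A Y = Y ** A - mat z ** Y"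
    by (simp add: vec_eq_iff)
  ultimately show ?case by simp
qed simp

lemma exists_annihilating_poly:
  fixes Y :: "complex ^ 'n ^ 'm"
  shows "\<exists>p. p \<noteq> 0 \<and> poly_mult p A Y = 0"
proof -
  obtain N c k where c: "k \<le> N" "c k \<noteq> 0" "(\<Sum>i\<le>N. c i *\<^sub>R ((\<lambda>M. M ** A) ^^ i) Y) = 0"
    by (rule exists_linear_relation)
  let ?p = "\<Sum>i\<le>N. monom (complex_of_real (c i)) i"
  have "coeff ?p k = complex_of_real (c k)"
    using c(1) by (simp add: coeff_sum)
  then have "?p \<noteq> 0" using c(2) by auto
  moreover have "mat (complex_of_real r) ** M = r *\<^sub>R M" for r and M :: "complex ^ 'n ^ 'm"
    by (simp add: vec_eq_iff scaleR_conv_of_real[where 'a = complex])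
  then have "poly_mult ?p A Y = 0"
    using c(3) by (simp add: poly_mult_sum poly_mult_monom)
  ultimately show ?thesis by blast
qed

lemma eigenvalue_of_right_mult:
  assumes "p \<noteq> 0" and "poly_mult p A Y = 0" and "Y \<noteq> 0" and "Y ** A = B ** Y"
  shows "\<exists>z Z. Z \<noteq> 0 \<and> Z ** A = mat z ** Z \<and> Z ** A = B ** Z"
  using assms
proof (induction "degree p" arbitrary: p Y)
  case 0
  then obtain a where a: "p = [:a:]" "a \<noteq> 0"
    by (metis degree_eq_zeroE pCons_0_0)
  then have "mat a ** Y = 0" using 0 by simp
  then have "Y = 0" using a(2) by (simp add: vec_eq_iff)
  then show ?case using 0 by simp
next
  case (Suc d)
  then have "\<not> constant (poly p)" by (simp add: constant_degree)
  then obtain z where "poly p z = 0" using fundamental_theorem_of_algebra by blast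
  then obtain r where r: "p = [:- z, 1:] * r" by (auto simp: poly_eq_0_iff_dvd)
  let ?Z = "Y ** A - mat z ** Y"
  show ?case
  proof (cases "?Z = 0")
    case True
    then show ?thesis using Suc.prems by (intro exI[of _ z] exI[of _ Y]) simp
  next
    case False
    have "r \<noteq> 0" using r Suc.prems(1) by auto
    then have "degree p = Suc (degree r)" using r by (simp add: degree_mult_eq del: mult_pCons_left)
    then have "d = degree r" using Suc.hyps(2) by simp
    moreover have "poly_mult r A ?Z = 0"
      using Suc.prems(2) r by (simp add: poly_mult_linear_factor del: mult_pCons_left)
    moreover have "?Z ** A = B ** ?Z"
      using Suc.prems(4) by (simp add: matrix_mult_distribs mat_mult_left_commute matrix_mul_assoc[symmetric])
    ultimately show ?thesis using Suc.hyps(1) \<open>r \<noteq> 0\<close> False by blast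
  qed
qed

lemma invertible_mult_eq_0:
  fixes M :: "complex ^ 'n ^ 'n"
  assumes "invertible M"
  shows "M ** N = 0 \<Longrightarrow> N = 0" and "L ** M = 0 \<Longrightarrow> L = 0"
proof -
  note inv = invertible_imp_two_sided[OF assms]
  show "N = 0" if "M ** N = 0"
    using arg_cong[OF that, of "\<lambda>Z. matrix_inv M ** Z"] by (simp add: matrix_mul_assoc inv)
  show "L = 0" if "L ** M = 0"
    using arg_cong[OF that, of "\<lambda>Z. Z ** matrix_inv M"] by (simp add: matrix_mul_assoc[symmetric] inv)
qed

lemma sylvester_homogeneous:
  assumes "spectrum A \<inter> spectrum B = {}" and "Y ** A = B ** Y"
  shows "Y = 0"
proof (rule ccontr)
  assume "Y \<noteq> 0"
  obtain p :: "complex poly" where "p \<noteq> 0" "poly_mult p A Y = 0" using exists_annihilating_poly by blast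
  from eigenvalue_of_right_mult[OF this \<open>Y \<noteq> 0\<close> assms(2)] obtain z Z
    where Z: "Z \<noteq> 0" "Z ** A = mat z ** Z" "Z ** A = B ** Z" by blast
  have "Z ** (A - mat z) = 0" and "(B - mat z) ** Z = 0"
    using Z(2,3) by (simp_all add: matrix_mult_distribs mat_mult_commute)
  then have "z \<in> spectrum A" "z \<in> spectrum B"
    using invertible_mult_eq_0 Z(1) by (auto simp: spectrum_def)
  then show False using assms(1) by blast
qed

lemma bounded_bilinear_lyapunov: "bounded_bilinear (\<lambda>A Y. Y ** A + dagger A ** Y)"
proof -
  have "bilinear (\<lambda>A Y :: complex ^ 'n ^ 'n. Y ** A + dagger A ** Y)"
    unfolding bilinear_def
    by (auto intro!: linearI
        simp: matrix_mult_distribs dagger_add dagger_scaleR scaleR_add_right)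
  then show ?thesis by (simp add: bilinear_conv_bounded_bilinear)
qed

lemma linear_lyapunov: "linear (\<lambda>Y. Y ** A + dagger A ** Y)"
  by (rule bounded_linear.linear[OF bounded_bilinear.bounded_linear_right[OF bounded_bilinear_lyapunov]])

lemma inj_lyapunov:
  assumes "spectrum A \<inter> spectrum (- dagger A) = {}"
  shows "inj (\<lambda>Y. Y ** A + dagger A ** Y)"
proof -
  have "Y = 0" if "Y ** A + dagger A ** Y = 0" for Y
    using that by (intro sylvester_homogeneous[OF assms])
      (simp add: matrix_mult_distribs eq_neg_iff_add_eq_0)
  then show ?thesis using linear_injective_0[OF linear_lyapunov] by blast
qed

lemma lyapunov_unique:
  assumes "spectrum A \<inter> spectrum (- dagger A) = {}"
    and "Y ** A + dagger A ** Y = Z ** A + dagger A ** Z"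
  shows "Y = Z"
  using assms(2) by (rule injD[OF inj_lyapunov[OF assms(1)]])

lemma lyapunov_ex1:
  assumes "spectrum A \<inter> spectrum (- dagger A) = {}"
  shows "\<exists>!Y. lyapunov A W Y"
proof -
  have "surj (\<lambda>Y. Y ** A + dagger A ** Y)"
    by (rule linear_injective_imp_surjective[OF linear_lyapunov inj_lyapunov[OF assms]]) (rule refl)
  then obtain Y where "W = Y ** A + dagger A ** Y" by (rule surjE)
  then show ?thesis
  proof (intro ex1I[of _ Y])
    show "lyapunov A W Y" using \<open>W = _\<close> by (simp add: lyapunov_def)
    fix Z assume "lyapunov A W Z"
    with \<open>W = _\<close> have "Z ** A + dagger A ** Z = Y ** A + dagger A ** Y"
      by (simp add: lyapunov_def)
    then show "Z = Y" by (rule lyapunov_unique[OF assms])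
  qed
qed

lemma inj_invertible_mult: "invertible A \<Longrightarrow> inj (\<lambda>Y. A ** (Y :: complex ^ 'n ^ 'n))"
  by (rule inj_on_inverseI[where g = "\<lambda>Y. matrix_inv A ** Y"])
    (simp add: matrix_mul_assoc invertible_imp_two_sided)

section \<open>Derivatives of the Lyapunov solution and of its inverse\<close>

lemma lyapunov_derivative_x:
  assumes spec: "spectrum A \<inter> spectrum (- dagger A) = {}"
    and S: "dagger S = S" "S ** W = W ** S"
    and lyap: "X ** A + dagger A ** X = W"
    and lyap': "X' ** A + dagger A ** X' = - (X ** A' + dagger A' ** X)"
    and A': "A' = (1/2) *\<^sub>R ((S ** A - A ** S) ** A)"
  shows "X' = (1/2) *\<^sub>R (W ** S - X ** S ** A - dagger A ** S ** X)"
proof -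
  let ?Z = "(1/2) *\<^sub>R (W ** S - X ** S ** A - dagger A ** S ** X)"
  have 1: "W ** S ** A = X ** A ** S ** A + dagger A ** X ** S ** A"
    by (simp add: lyap[symmetric] matrix_mult_distribs)
  have "dagger A ** W ** S = dagger A ** (S ** W)"
    using S(2) by (simp add: matrix_mul_assoc[symmetric])
  then have 2: "dagger A ** W ** S = dagger A ** S ** X ** A + dagger A ** S ** dagger A ** X"
    by (simp add: lyap[symmetric] matrix_mult_distribs matrix_mul_assoc)
  have 3: "dagger A' = (1/2) *\<^sub>R (dagger A ** (dagger A ** S - S ** dagger A))"
    using S(1) by (simp add: A' dagger_scaleR dagger_mult dagger_diff)
  have "?Z ** A + dagger A ** ?Z = - (X ** A' + dagger A' ** X)"
    unfolding 3 unfolding A'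
    by (simp add: matrix_mult_distribs matrix_mul_assoc 1 2 algebra_simps)
  with lyap' have "X' ** A + dagger A ** X' = ?Z ** A + dagger A ** ?Z" by simp
  then show ?thesis by (rule lyapunov_unique[OF spec])
qed

lemma lyapunov_derivative_t:
  assumes spec: "spectrum A \<inter> spectrum (- dagger A) = {}"
    and y: "Xy ** A + dagger A ** Xy = - (X ** Ay + dagger Ay ** X)"
    and t: "Xt ** A + dagger A ** Xt = - (X ** At + dagger At ** X)"
    and At: "mat \<i> ** At = - (Ay ** A)"
  shows "mat \<i> ** Xt = X ** Ay + dagger A ** Xy"
proof -
  let ?Z = "mat (- \<i>) ** (X ** Ay + dagger A ** Xy)"
  have At: "At = mat \<i> ** (Ay ** A)"
    using arg_cong[OF At, of "\<lambda>M. mat (- \<i>) ** M"]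
    by (simp only: mat_mult_mat_mult) (simp add: mat_uminus matrix_mult_distribs)
  have At': "dagger At = mat (- \<i>) ** (dagger A ** dagger Ay)"
    by (simp add: At dagger_mult dagger_mat) (rule mat_mult_commute[symmetric])
  have y': "dagger A ** Xy ** A + dagger A ** dagger A ** Xy = - (dagger A ** X ** Ay + dagger A ** dagger Ay ** X)"
    using arg_cong[OF y, of "\<lambda>M. dagger A ** M"] by (simp add: matrix_mult_distribs matrix_mul_assoc)
  have "?Z ** A + dagger A ** ?Z = mat (- \<i>) ** (X ** Ay ** A + dagger A ** X ** Ay
      + (dagger A ** Xy ** A + dagger A ** dagger A ** Xy))"
    by (simp add: matrix_mult_distribs matrix_mul_assoc[symmetric] mat_mult_left_commute algebra_simps)
  also have "\<dots> = mat (- \<i>) ** (X ** Ay ** A - dagger A ** dagger Ay ** X)"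
    unfolding y' by simp
  also have "\<dots> = - (X ** At + dagger At ** X)"
    unfolding At' unfolding At
    by (simp add: mat_uminus matrix_mult_distribs matrix_mul_assoc[symmetric] mat_mult_left_commute)
  finally have "Xt ** A + dagger A ** Xt = ?Z ** A + dagger A ** ?Z" using t by simp
  then have "Xt = ?Z" by (rule lyapunov_unique[OF spec])
  then show ?thesis by (simp only: mat_mult_mat_mult) simp
qed

lemma inverse_derivative_x:
  fixes X K :: "complex ^ 'n ^ 'n"
  assumes XK: "X ** K = mat 1" and KX: "K ** X = mat 1"
    and X': "X' = (1/2) *\<^sub>R (W ** S - X ** S ** A - B ** S ** X)"
  shows "- (K ** X' ** K) = (1/2) *\<^sub>R (S ** A ** K + K ** B ** S - K ** W ** S ** K)"
proof -
  have "M ** X ** K = M" for M :: "complex ^ 'n ^ 'n"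
    using XK by (simp add: matrix_mul_assoc[symmetric])
  with KX show ?thesis
    by (simp add: X' matrix_mult_distribs matrix_mul_assoc algebra_simps)
qed

lemma inverse_derivative_t:
  fixes X K :: "complex ^ 'n ^ 'n"
  assumes XK: "X ** K = mat 1" and KX: "K ** X = mat 1"
    and lyap: "X ** A + B ** X = W"
    and X': "mat \<i> ** Xt = X ** Ay + B ** Xy"
    and Ky: "Ky = - (K ** Xy ** K)" and Kt: "Kt = - (K ** Xt ** K)"
  shows "mat (- \<i>) ** Kt = Ay ** K + A ** Ky - K ** W ** Ky"
proof -
  have "mat (- \<i>) ** Kt = K ** (mat \<i> ** Xt) ** K"
    by (simp add: Kt mat_uminus matrix_mult_distribs mat_mult_left_commute matrix_mul_assoc[symmetric])
  also have "\<dots> = K ** X ** Ay ** K + K ** B ** Xy ** K"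
    by (simp add: X' matrix_mult_distribs matrix_mul_assoc)
  finally have 1: "mat (- \<i>) ** Kt = Ay ** K + K ** B ** Xy ** K" using KX by simp
  have "X ** Ky = - (Xy ** K)"
    using XK by (simp add: Ky matrix_mult_distribs matrix_mul_assoc)
  then have 2: "K ** B ** X ** Ky = - (K ** B ** Xy ** K)"
    by (simp add: matrix_mul_assoc[symmetric] matrix_mult_distribs)
  have "K ** W ** Ky = K ** X ** A ** Ky + K ** B ** X ** Ky"
    by (simp add: lyap[symmetric] matrix_mult_distribs matrix_mul_assoc)
  then show ?thesis using KX by (simp add: 1 2)
qed

section \<open>Block decomposition\<close>

definition block_r :: "complex ^ ('m1::finite + 'm2::finite) ^ ('m1 + 'm2) \<Rightarrow> complex ^ 'm1 ^ 'm2" where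
  "block_r A = (\<chi> i j. A $ Inr i $ Inl j)"

lemma sum_UNIV_Plus:
  "(\<Sum>k\<in>(UNIV :: ('a::finite + 'b::finite) set). f k) = (\<Sum>i\<in>UNIV. f (Inl i)) + (\<Sum>j\<in>UNIV. f (Inr j))"
  by (simp add: UNIV_Plus_UNIV[symmetric] sum.Plus del: UNIV_Plus_UNIV)

lemma block_mult:
  "block_u (M ** N) = block_u M ** block_u N + block_q M ** block_r N"
  "block_q (M ** N) = block_u M ** block_q N + block_q M ** block_v N"
  "block_r (M ** N) = block_r M ** block_u N + block_v M ** block_r N"
  "block_v (M ** N) = block_r M ** block_q N + block_v M ** block_v N"
  by (simp_all add: block_u_def block_q_def block_r_def block_v_def matrix_matrix_mult_def
      vec_eq_iff sum_UNIV_Plus)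

lemma block_J:
  "block_u J = mat 1" "block_q J = 0" "block_r J = 0" "block_v J = - mat 1"
  by (simp_all add: block_u_def block_q_def block_r_def block_v_def J_def mat_def vec_eq_iff)

lemma bounded_linear_block:
  "bounded_linear block_u" "bounded_linear block_q" "bounded_linear block_r" "bounded_linear block_v"
  by (simp_all add: linear_conv_bounded_linear[symmetric] linear_iff
      block_u_def block_q_def block_r_def block_v_def vec_eq_iff)

lemmas block_linear =
  bounded_linear_block(1)[THEN bounded_linear.linear, THEN linear_add]
  bounded_linear_block(2)[THEN bounded_linear.linear, THEN linear_add]
  bounded_linear_block(3)[THEN bounded_linear.linear, THEN linear_add]
  bounded_linear_block(4)[THEN bounded_linear.linear, THEN linear_add]
  bounded_linear_block(1)[THEN bounded_linear.linear, THEN linear_diff]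
  bounded_linear_block(2)[THEN bounded_linear.linear, THEN linear_diff]
  bounded_linear_block(3)[THEN bounded_linear.linear, THEN linear_diff]
  bounded_linear_block(4)[THEN bounded_linear.linear, THEN linear_diff]
  bounded_linear_block(1)[THEN bounded_linear.linear, THEN linear_scale]
  bounded_linear_block(2)[THEN bounded_linear.linear, THEN linear_scale]
  bounded_linear_block(3)[THEN bounded_linear.linear, THEN linear_scale]
  bounded_linear_block(4)[THEN bounded_linear.linear, THEN linear_scale]

lemma block_q_mat_mult: "block_q (mat z ** M) = mat z ** block_q M"
  by (simp add: block_q_def vec_eq_iff)

lemma dagger_block_r: "dagger (block_r M) = block_q (dagger M)"
  by (simp add: block_q_def block_r_def dagger_def vec_eq_iff)

lemma diagonal_signs_square:
  assumes "diagonal_signs S"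
  shows "S ** S = mat 1"
proof -
  have "(\<Sum>k\<in>UNIV. S $ i $ k * S $ k $ j) = (if i = j then 1 else 0)" for i j
  proof -
    have "(\<Sum>k\<in>UNIV. S $ i $ k * S $ k $ j) = (\<Sum>k\<in>UNIV. if k = i then S $ i $ i * S $ i $ j else 0)"
      using assms by (intro sum.cong) (auto simp: diagonal_signs_def)
    moreover
    have "S $ i $ i = 1 \<or> S $ i $ i = - 1"
      using assms by (simp add: diagonal_signs_def)
    then have "S $ i $ i * S $ i $ i = 1" by auto
    ultimately show ?thesis using assms by (auto simp: diagonal_signs_def)
  qed
  then show ?thesis by (simp add: matrix_matrix_mult_def mat_def vec_eq_iff)
qed

lemma diagonal_signs_dagger:
  assumes "diagonal_signs S"
  shows "dagger S = S"
proof -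
  have "cnj (S $ j $ i) = S $ i $ j" for i j
    using assms by (cases "i = j") (auto simp: diagonal_signs_def dest!: spec[of _ i])
  then show ?thesis by (simp add: dagger_def vec_eq_iff)
qed

lemma diagonal_signs_J: "diagonal_signs J"
  by (auto simp: diagonal_signs_def J_def split: sum.split)

lemmas J_mult_J [simp] = diagonal_signs_square[OF diagonal_signs_J]

lemmas dagger_J [simp] = diagonal_signs_dagger[OF diagonal_signs_J]

lemma J_J_mult: "J ** (J ** M) = M"
  by (simp add: matrix_mul_assoc)

lemma block_q_J_mult: "block_q (J ** M) = block_q M"
  by (simp add: block_mult block_J)

lemma block_derivative_x:
  fixes \<psi> G \<psi>' :: "complex ^ ('m1::finite + 'm2::finite) ^ ('m1 + 'm2)"
  assumes "\<psi>' = (1/2) *\<^sub>R (G - J ** G ** J + \<psi> ** J ** \<psi> ** J - \<psi> ** \<psi>)"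
  shows "block_u \<psi>' = - (block_q \<psi> ** block_r \<psi>)"
    and "block_q \<psi>' = block_q G - block_u \<psi> ** block_q \<psi>"
    and "block_v \<psi>' = - (block_r \<psi> ** block_q \<psi>)"
proof -
  have half: "(1/2) *\<^sub>R (- M - M) = - M" "(1/2) *\<^sub>R (M + M) = M" for M :: "complex ^ 'a ^ 'b"
    by (simp_all add: vec_eq_iff)
  have "block_u \<psi>' = (1/2) *\<^sub>R (- (block_q \<psi> ** block_r \<psi>) - block_q \<psi> ** block_r \<psi>)"
    by (simp add: assms block_linear block_mult block_J matrix_mult_distribs)
  then show "block_u \<psi>' = - (block_q \<psi> ** block_r \<psi>)" by (simp only: half)
  have "block_q \<psi>' = (1/2) *\<^sub>R ((block_q G - block_u \<psi> ** block_q \<psi>) + (block_q G - block_u \<psi> ** block_q \<psi>))"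
    by (simp add: assms block_linear block_mult block_J matrix_mult_distribs algebra_simps)
  then show "block_q \<psi>' = block_q G - block_u \<psi> ** block_q \<psi>" by (simp only: half)
  have "block_v \<psi>' = (1/2) *\<^sub>R (- (block_r \<psi> ** block_q \<psi>) - block_r \<psi> ** block_q \<psi>)"
    by (simp add: assms block_linear block_mult block_J matrix_mult_distribs)
  then show "block_v \<psi>' = - (block_r \<psi> ** block_q \<psi>)" by (simp only: half)
qed

section \<open>Partial derivatives and the scalar equation\<close>

lemma d_x_has_derivative:
  assumes "(f has_derivative f') (at p)"
  shows "d_x f p = f' (1, 0, 0)"
proof -
  obtain x y t where p: "p = (x, y, t)" by (cases p)
  have "((\<lambda>s. (s, y, t)) has_vector_derivative (1, 0, 0)) (at x)"
    by (auto intro!: derivative_eq_intros simp: has_vector_derivative_def zero_prod_def)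
  from vector_derivative_diff_chain_within[OF this has_derivative_at_withinI[OF assms[unfolded p]]]
  have "((\<lambda>s. f (s, y, t)) has_vector_derivative f' (1, 0, 0)) (at x)"
    by (simp add: o_def)
  then show ?thesis by (simp add: d_x_def p vector_derivative_at)
qed

lemma d_y_has_derivative:
  assumes "(f has_derivative f') (at p)"
  shows "d_y f p = f' (0, 1, 0)"
proof -
  obtain x y t where p: "p = (x, y, t)" by (cases p)
  have "((\<lambda>s. (x, s, t)) has_vector_derivative (0, 1, 0)) (at y)"
    by (auto intro!: derivative_eq_intros simp: has_vector_derivative_def zero_prod_def)
  from vector_derivative_diff_chain_within[OF this has_derivative_at_withinI[OF assms[unfolded p]]]
  have "((\<lambda>s. f (x, s, t)) has_vector_derivative f' (0, 1, 0)) (at y)"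
    by (simp add: o_def)
  then show ?thesis by (simp add: d_y_def p vector_derivative_at)
qed

lemma d_t_has_derivative:
  assumes "(f has_derivative f') (at p)"
  shows "d_t f p = f' (0, 0, 1)"
proof -
  obtain x y t where p: "p = (x, y, t)" by (cases p)
  have "((\<lambda>s. (x, y, s)) has_vector_derivative (0, 0, 1)) (at t)"
    by (auto intro!: derivative_eq_intros simp: has_vector_derivative_def zero_prod_def)
  from vector_derivative_diff_chain_within[OF this has_derivative_at_withinI[OF assms[unfolded p]]]
  have "((\<lambda>s. f (x, y, s)) has_vector_derivative f' (0, 0, 1)) (at t)"
    by (simp add: o_def)
  then show ?thesis by (simp add: d_t_def p vector_derivative_at)
qed

lemma has_derivative_matrix_entry:
  fixes f :: "'a::real_normed_vector \<Rightarrow> complex ^ 'c ^ 'r"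
  shows "(f has_derivative f') F \<Longrightarrow> ((\<lambda>p. f p $ a $ b) has_derivative (\<lambda>h. f' h $ a $ b)) F"
  by (rule bounded_linear.has_derivative[OF bounded_linear_compose[OF bounded_linear_vec_nth bounded_linear_vec_nth]])

lemma smooth_on_has_derivative:
  "smooth_on D f \<Longrightarrow> p \<in> D \<Longrightarrow> (f has_derivative frechet_derivative f (at p)) (at p)"
  unfolding smooth_on_def using Ck_on_Suc_differentiable by blast

lemma smooth_on_bounded_linear:
  "open D \<Longrightarrow> bounded_linear L \<Longrightarrow> smooth_on D f \<Longrightarrow> smooth_on D (\<lambda>p. L (f p))"
  by (simp add: smooth_on_def Ck_on_bounded_linear)

lemma smooth_on_d_x_has_derivative:
  assumes "open D" and "smooth_on D f" and "p \<in> D"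
  obtains g where "(d_x f has_derivative g) (at p)"
proof -
  have "Ck_on (Suc (Suc 0)) D f" using assms(2) unfolding smooth_on_def by blast
  then have "Ck_on (Suc 0) D (\<lambda>p. frechet_derivative f (at p) (1, 0, 0))"
    by (rule Ck_on.simps(2)[THEN iffD1, THEN conjunct2, THEN spec])
  from Ck_on_Suc_differentiable[OF this assms(3)]
  obtain g where g: "((\<lambda>p. frechet_derivative f (at p) (1, 0, 0)) has_derivative g) (at p)" ..
  have "frechet_derivative f (at p) (1, 0, 0) = d_x f p" if "p \<in> D" for p
    using d_x_has_derivative[OF smooth_on_has_derivative[OF assms(2) that]] by (rule sym)
  from has_derivative_transform_within_open[OF g assms(1,3) this] show ?thesis by (rule that)
qed

lemma solves_scalar_NLS_of_matrix_NLS: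
  fixes u :: "point \<Rightarrow> complex ^ 'm1 ^ 'm1" and q :: "point \<Rightarrow> complex ^ 'm2 ^ 'm1"
  assumes E: "open E" and sol: "solves_matrix_NLS c E u q v"
    and card: "CARD('m1) = 1" "CARD('m2) = 1"
  shows "solves_scalar_NLS c E (\<lambda>p. q p $ a $ b)
    (\<lambda>p. - of_real (pm c / 2) * (u p $ a $ a + v p $ b $ b))"
proof -
  let ?w = "\<lambda>p. - of_real (pm c / 2) * (u p $ a $ a + v p $ b $ b)"
  have sm: "smooth_on E u" "smooth_on E q" "smooth_on E v"
    using sol by (simp_all add: solves_matrix_NLS_def)
  have eqs: "mat (- \<i>) ** d_t q p = d_y (d_x q) p + q p ** d_y v p + d_y u p ** q p"
    "d_x u p = - (pm c *\<^sub>R (q p ** dagger (q p)))"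
    "d_x v p = - (pm c *\<^sub>R (dagger (q p) ** q p))" if "p \<in> E" for p
    using sol that by (simp_all add: solves_matrix_NLS_def)
  obtain a' :: 'm1 and b' :: 'm2 where "UNIV = {a'}" "UNIV = {b'}"
    using card by (auto simp: card_1_singleton_iff)
  then have UNIV: "UNIV = {a}" "UNIV = {b}"
    by (metis UNIV_I singletonD)+
  have entry: "(M ** N) $ i $ j = M $ i $ a * N $ a $ j"
    for M :: "complex ^ 'm1 ^ 'k" and N :: "complex ^ 'l ^ 'm1" and i j
    by (simp add: matrix_matrix_mult_def UNIV)
  have entry': "(M ** N) $ i $ j = M $ i $ b * N $ b $ j"
    for M :: "complex ^ 'm2 ^ 'k" and N :: "complex ^ 'l ^ 'm2" and i j
    by (simp add: matrix_matrix_mult_def UNIV)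
  have pm2: "complex_of_real (pm c) * complex_of_real (pm c) = 1" by (cases c) auto
  have blin: "bounded_linear (\<lambda>M :: complex ^ 'l ^ 'k. M $ i $ j)" for i j
    by (rule bounded_linear_compose[OF bounded_linear_vec_nth bounded_linear_vec_nth])
  have smw: "smooth_on E ?w"
    unfolding smooth_on_def
  proof
    fix k
    have "Ck_on k E u" "Ck_on k E v" using sm by (simp_all add: smooth_on_def)
    then have "Ck_on k E (\<lambda>p. u p $ a $ a + v p $ b $ b)"
      by (simp add: Ck_on_add Ck_on_bounded_linear[OF _ blin] E)
    then show "Ck_on k E ?w"
      by (rule Ck_on_bounded_linear[OF E bounded_linear_mult_right])
  qed
  have w': "(?w has_derivative (\<lambda>h. - of_real (pm c / 2) *
      (frechet_derivative u (at p) h $ a $ a + frechet_derivative v (at p) h $ b $ b))) (at p)"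
    if "p \<in> E" for p
    by (intro bounded_linear.has_derivative[OF bounded_linear_mult_right] has_derivative_add
        has_derivative_matrix_entry smooth_on_has_derivative[OF sm(1) that]
        smooth_on_has_derivative[OF sm(3) that])
  have "d_x ?w p = of_real ((cmod (q p $ a $ b))\<^sup>2)" if p: "p \<in> E" for p
  proof -
    note du = d_x_has_derivative[OF smooth_on_has_derivative[OF sm(1) p]]
    note dv = d_x_has_derivative[OF smooth_on_has_derivative[OF sm(3) p]]
    have "d_x ?w p = - of_real (pm c / 2) * (d_x u p $ a $ a + d_x v p $ b $ b)"
      by (simp only: d_x_has_derivative[OF w'[OF p]] du dv)
    also have "\<dots> = of_real (pm c) * of_real (pm c) * (q p $ a $ b * cnj (q p $ a $ b))"
      by (simp add: eqs[OF p] entry entry' dagger_def scaleR_conv_of_real[where 'a = complex])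
    finally show ?thesis
      unfolding pm2 complex_norm_square by simp
  qed
  moreover have "\<i> * d_t (\<lambda>p. q p $ a $ b) p + d_y (d_x (\<lambda>p. q p $ a $ b)) p
      - of_real (pm c) * 2 * (q p $ a $ b) * d_y ?w p = 0" if p: "p \<in> E" for p
  proof -
    note qd = smooth_on_has_derivative[OF sm(2)]
    have t: "d_t (\<lambda>p. q p $ a $ b) p = d_t q p $ a $ b"
      by (simp only: d_t_has_derivative[OF qd[OF p]]
          d_t_has_derivative[OF has_derivative_matrix_entry[OF qd[OF p]]])
    have x: "d_x (\<lambda>p. q p $ a $ b) p = d_x q p $ a $ b" if "p \<in> E" for p
      by (simp only: d_x_has_derivative[OF qd[OF that]]
          d_x_has_derivative[OF has_derivative_matrix_entry[OF qd[OF that]]])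
    obtain g where g: "(d_x q has_derivative g) (at p)"
      by (rule smooth_on_d_x_has_derivative[OF E sm(2) p])
    have "(d_x (\<lambda>p. q p $ a $ b) has_derivative (\<lambda>h. g h $ a $ b)) (at p)"
      by (rule has_derivative_transform_within_open[OF has_derivative_matrix_entry[OF g] E p])
        (simp add: x)
    then have xy: "d_y (d_x (\<lambda>p. q p $ a $ b)) p = d_y (d_x q) p $ a $ b"
      by (simp only: d_y_has_derivative d_y_has_derivative[OF g])
    have y: "d_y ?w p = - of_real (pm c / 2) * (d_y u p $ a $ a + d_y v p $ b $ b)"
      by (simp only: d_y_has_derivative[OF w'[OF p]]
          d_y_has_derivative[OF smooth_on_has_derivative[OF sm(1) p]]
          d_y_has_derivative[OF smooth_on_has_derivative[OF sm(3) p]])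
    have "- \<i> * d_t q p $ a $ b = d_y (d_x q) p $ a $ b
        + q p $ a $ b * d_y v p $ b $ b + d_y u p $ a $ a * q p $ a $ b"
      using arg_cong[OF eqs(1)[OF p], of "\<lambda>M. M $ a $ b"] by (simp add: entry entry' mat_def)
    then have 1: "\<i> * d_t q p $ a $ b + d_y (d_x q) p $ a $ b
        + q p $ a $ b * (d_y u p $ a $ a + d_y v p $ b $ b) = 0"
      by (simp add: algebra_simps neg_eq_iff_add_eq_0)
    have "of_real (pm c) * 2 * (q p $ a $ b) * d_y ?w p
      = - (of_real (pm c) * of_real (pm c)) * (q p $ a $ b * (d_y u p $ a $ a + d_y v p $ b $ b))"
      unfolding y by (simp add: field_simps)
    then show ?thesis using 1 by (simp add: t xy pm2)
  qed
  ultimately show ?thesis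
    using smw smooth_on_bounded_linear[OF E blin sm(2)] by (simp add: solves_scalar_NLS_def)
qed

lemma continuous_on_det:
  fixes f :: "'a::topological_space \<Rightarrow> complex ^ 'n ^ 'n"
  assumes "continuous_on D f"
  shows "continuous_on D (\<lambda>p. det (f p))"
  unfolding det_def by (intro continuous_intros continuous_on_component assms)

section \<open>The dressed solution\<close>

locale lyapunov_solution =
  fixes c :: reduction
    and D :: "point set"
    and JJ :: "complex ^ 'n ^ 'n"
    and P X :: "point \<Rightarrow> complex ^ 'n ^ 'n"
    and U0 :: "complex ^ 'n ^ ('m1::finite + 'm2::finite)"
    and V0 :: "complex ^ ('m1 + 'm2) ^ 'n"
  assumes open_D: "open D"
    and signs: "diagonal_signs JJ"
    and smooth_P: "smooth_on D P"
    and P_t: "\<And>p. p \<in> D \<Longrightarrow> mat \<i> ** d_t P p + d_y P p ** JJ ** P p = 0"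
    and P_x: "\<And>p. p \<in> D \<Longrightarrow> d_x P p = (1/2) *\<^sub>R ((JJ ** P p ** JJ - P p) ** P p)"
    and spec_P: "\<And>p. p \<in> D \<Longrightarrow> spectrum (JJ ** P p) \<inter> spectrum (- (dagger (P p) ** JJ)) = {}"
    and J_U0: "J ** U0 = U0 ** JJ"
    and V0_eq: "V0 = V0_of c U0"
    and lyap_X: "\<And>p. p \<in> D \<Longrightarrow> lyapunov (JJ ** P p) (V0 ** U0) (X p)"
begin

definition A where "A p = JJ ** P p"
definition K where "K p = matrix_inv (X p)"
definition W where "W = V0 ** U0"
definition \<psi> where "\<psi> p = J ** U0 ** K p ** V0"
definition G where "G p = U0 ** A p ** K p ** V0"
definition E where "E = {p \<in> D. invertible (X p)}"

lemma JJ_square: "JJ ** JJ = mat 1"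
  by (rule diagonal_signs_square[OF signs])

lemma dagger_JJ: "dagger JJ = JJ"
  by (rule diagonal_signs_dagger[OF signs])

lemma JJ_dagger_U0: "JJ ** dagger U0 = dagger U0 ** J"
  using arg_cong[OF J_U0, of dagger] by (simp add: dagger_mult dagger_JJ)

lemma JJ_V0: "JJ ** V0 = V0 ** J"
  by (cases c) (simp_all add: V0_eq matrix_mul_assoc JJ_dagger_U0)

lemma JJ_W: "JJ ** W = W ** JJ"
  by (simp add: W_def matrix_mul_assoc JJ_V0) (simp add: matrix_mul_assoc[symmetric] J_U0)

lemma dagger_W: "dagger W = W"
  unfolding W_def by (cases c) (simp_all add: V0_eq dagger_mult matrix_mul_assoc)

lemma spec_A: "p \<in> D \<Longrightarrow> spectrum (A p) \<inter> spectrum (- dagger (A p)) = {}"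
  using spec_P by (simp add: A_def dagger_mult dagger_JJ)

lemma lyap_A: "p \<in> D \<Longrightarrow> X p ** A p + dagger (A p) ** X p = W"
  using lyap_X by (simp add: lyapunov_def A_def W_def)

lemma dagger_X:
  assumes "p \<in> D"
  shows "dagger (X p) = X p"
proof (rule lyapunov_unique[OF spec_A[OF assms]])
  have "dagger W = dagger (X p) ** A p + dagger (A p) ** dagger (X p)"
    by (subst lyap_A[OF assms, symmetric]) (simp add: dagger_add dagger_mult add.commute)
  then show "dagger (X p) ** A p + dagger (A p) ** dagger (X p) = X p ** A p + dagger (A p) ** X p"
    by (simp add: dagger_W lyap_A[OF assms])
qed

lemma smooth_A: "smooth_on D A"
  using smooth_on_bounded_linear[OF open_D matrix_mult.bounded_linear_right smooth_P]
  by (simp add: A_def[abs_def])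

lemma smooth_X: "smooth_on D X"
  unfolding smooth_on_def
proof
  fix k
  show "Ck_on k D X"
  proof (rule Ck_on_bilinear_solution[OF bounded_bilinear_lyapunov open_D])
    show "Ck_on k D A" using smooth_A by (simp add: smooth_on_def)
    show "Ck_on k D (\<lambda>_. W)" by (rule Ck_on_const)
  qed (simp_all add: inj_lyapunov spec_A lyap_A)
qed

lemma E_subset_D: "E \<subseteq> D"
  by (auto simp: E_def)

lemma open_E: "open E"
proof -
  have "continuous_on D X"
    using smooth_X Ck_on_imp_continuous_on by (auto simp: smooth_on_def)
  from continuous_open_preimage[OF continuous_on_det[OF this] open_D, of "- {0}"]
  have "open (D \<inter> (\<lambda>p. det (X p)) -` (- {0}))" by auto
  moreover have "D \<inter> (\<lambda>p. det (X p)) -` (- {0}) = E"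
    by (auto simp: E_def invertible_det_nz)
  ultimately show ?thesis by simp
qed

lemma X_K: "p \<in> E \<Longrightarrow> X p ** K p = mat 1" and K_X: "p \<in> E \<Longrightarrow> K p ** X p = mat 1"
  by (simp_all add: E_def K_def invertible_imp_two_sided)

lemma dagger_K:
  assumes "p \<in> E"
  shows "dagger (K p) = K p"
proof -
  have "dagger (K p) ** X p = mat 1"
    using arg_cong[OF X_K[OF assms], of dagger] dagger_X[OF subsetD[OF E_subset_D assms]]
    by (simp add: dagger_mult dagger_mat)
  then have "dagger (K p) ** (X p ** K p) = K p" by (simp add: matrix_mul_assoc)
  then show ?thesis by (simp add: X_K[OF assms])
qed

lemma smooth_K: "smooth_on E K"
  unfolding smooth_on_def
proof
  fix k
  show "Ck_on k E K"
  proof (rule Ck_on_bilinear_solution[OF bounded_bilinear_matrix_mult open_E])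
    show "Ck_on k E X" using smooth_X Ck_on_subset[OF _ E_subset_D] by (auto simp: smooth_on_def)
    show "Ck_on k E (\<lambda>_. mat 1 :: complex ^ 'n ^ 'n)" by (rule Ck_on_const)
    show "inj (\<lambda>Y :: complex ^ 'n ^ 'n. X p ** Y)" if "p \<in> E" for p
      using that by (simp add: inj_invertible_mult E_def)
  qed (simp_all add: X_K)
qed

abbreviation "A' p \<equiv> frechet_derivative A (at p)"
abbreviation "X' p \<equiv> frechet_derivative X (at p)"
abbreviation "K' p \<equiv> frechet_derivative K (at p)"

lemma has_derivative_A: "p \<in> E \<Longrightarrow> (A has_derivative A' p) (at p)"
  and has_derivative_X: "p \<in> E \<Longrightarrow> (X has_derivative X' p) (at p)"
  and has_derivative_K: "p \<in> E \<Longrightarrow> (K has_derivative K' p) (at p)"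
  using smooth_on_has_derivative smooth_A smooth_X smooth_K E_subset_D by blast+

lemma K'_eq:
  assumes p: "p \<in> E"
  shows "K' p h = - (K p ** X' p h ** K p)"
proof -
  have "((\<lambda>p. X p ** K p) has_derivative (\<lambda>h. X p ** K' p h + X' p h ** K p)) (at p)"
    by (rule matrix_mult.FDERIV[OF has_derivative_X[OF p] has_derivative_K[OF p]])
  note unique = has_derivative_unique[OF this]
  have "(\<lambda>h. X p ** K' p h + X' p h ** K p) = (\<lambda>h. 0)"
    by (rule unique[OF has_derivative_transform_within_open[OF has_derivative_const open_E p X_K[symmetric]]])
  then have "X p ** K' p h + X' p h ** K p = 0" by meson
  then have "K p ** (X p ** K' p h + X' p h ** K p) = 0" by simp
  then show ?thesis
    by (simp add: matrix_mult_distribs matrix_mul_assoc K_X[OF p] eq_neg_iff_add_eq_0)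
qed

lemma X'_eq:
  assumes p: "p \<in> E"
  shows "X' p h ** A p + dagger (A p) ** X' p h = - (X p ** A' p h + dagger (A' p h) ** X p)"
proof -
  have "((\<lambda>p. X p ** A p + dagger (A p) ** X p) has_derivative
      (\<lambda>h. (X p ** A' p h + X' p h ** A p) + (dagger (A p) ** X' p h + dagger (A' p h) ** X p))) (at p)"
    by (rule has_derivative_add[OF matrix_mult.FDERIV[OF has_derivative_X[OF p] has_derivative_A[OF p]]
          matrix_mult.FDERIV[OF bounded_linear.has_derivative[OF bounded_linear_dagger
              has_derivative_A[OF p]] has_derivative_X[OF p]]])
  note unique = has_derivative_unique[OF this]
  have "(\<lambda>h. (X p ** A' p h + X' p h ** A p) + (dagger (A p) ** X' p h + dagger (A' p h) ** X p)) = (\<lambda>h. 0)"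
    by (rule unique[OF has_derivative_transform_within_open[OF has_derivative_const open_E p
          lyap_A[OF subsetD[OF E_subset_D], symmetric]]])
  then have "(X p ** A' p h + X' p h ** A p) + (dagger (A p) ** X' p h + dagger (A' p h) ** X p) = 0"
    by meson
  then show ?thesis by (subst eq_neg_iff_add_eq_0) (simp add: add_ac)
qed

lemma A'_eq:
  assumes p: "p \<in> E"
  shows "A' p h = JJ ** frechet_derivative P (at p) h"
proof -
  have "(P has_derivative frechet_derivative P (at p)) (at p)"
    using p E_subset_D by (intro smooth_on_has_derivative[OF smooth_P]) auto
  from bounded_linear.has_derivative[OF matrix_mult.bounded_linear_right this]
  have "(A has_derivative (\<lambda>h. JJ ** frechet_derivative P (at p) h)) (at p)"
    by (simp add: A_def[abs_def])
  from has_derivative_unique[OF has_derivative_A[OF p] this] show ?thesis by simp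
qed

lemma P_derivatives:
  assumes p: "p \<in> E"
  shows "frechet_derivative P (at p) (1, 0, 0) = d_x P p"
    and "frechet_derivative P (at p) (0, 1, 0) = d_y P p"
    and "frechet_derivative P (at p) (0, 0, 1) = d_t P p"
proof -
  have "(P has_derivative frechet_derivative P (at p)) (at p)"
    using p E_subset_D by (intro smooth_on_has_derivative[OF smooth_P]) auto
  then show "frechet_derivative P (at p) (1, 0, 0) = d_x P p"
    and "frechet_derivative P (at p) (0, 1, 0) = d_y P p"
    and "frechet_derivative P (at p) (0, 0, 1) = d_t P p"
    by (simp_all add: d_x_has_derivative d_y_has_derivative d_t_has_derivative)
qed

lemma A_x:
  assumes p: "p \<in> E"
  shows "A' p (1, 0, 0) = (1/2) *\<^sub>R ((JJ ** A p - A p ** JJ) ** A p)"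
proof -
  have "p \<in> D" using p E_subset_D by auto
  have "A' p (1, 0, 0) = (1/2) *\<^sub>R ((JJ ** JJ ** P p ** JJ - JJ ** P p) ** P p)"
    by (simp add: A'_eq[OF p] P_derivatives[OF p] P_x[OF \<open>p \<in> D\<close>] matrix_mult_distribs matrix_mul_assoc)
  moreover have "JJ ** A p = P p" by (simp add: A_def matrix_mul_assoc JJ_square)
  moreover have "P p ** JJ ** P p = P p ** A p" by (simp add: A_def matrix_mul_assoc)
  moreover have "A p ** JJ ** A p = A p ** P p"
    by (simp add: A_def matrix_mul_assoc) (simp add: matrix_mul_assoc[symmetric] JJ_square)
  ultimately show ?thesis by (simp add: matrix_mult_distribs JJ_square A_def)
qed

lemma A_t:
  assumes p: "p \<in> E"
  shows "mat \<i> ** A' p (0, 0, 1) = - (A' p (0, 1, 0) ** A p)"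
proof -
  have "p \<in> D" using p E_subset_D by auto
  then have "JJ ** (mat \<i> ** d_t P p + d_y P p ** JJ ** P p) = 0" by (simp add: P_t)
  then show ?thesis
    by (simp add: A'_eq[OF p] P_derivatives[OF p] eq_neg_iff_add_eq_0 matrix_mult_distribs
        mat_mult_left_commute A_def matrix_mul_assoc[symmetric])
qed

lemma K_x:
  assumes p: "p \<in> E"
  shows "K' p (1, 0, 0) =
    (1/2) *\<^sub>R (JJ ** A p ** K p + K p ** dagger (A p) ** JJ - K p ** W ** JJ ** K p)"
proof -
  have "p \<in> D" using p E_subset_D by auto
  note X_x = lyapunov_derivative_x[OF spec_A[OF \<open>p \<in> D\<close>] dagger_JJ JJ_W lyap_A[OF \<open>p \<in> D\<close>]
      X'_eq[OF p] A_x[OF p]]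
  show ?thesis
    unfolding K'_eq[OF p] by (rule inverse_derivative_x[OF X_K[OF p] K_X[OF p] X_x])
qed

lemma K_t:
  assumes p: "p \<in> E"
  shows "mat (- \<i>) ** K' p (0, 0, 1) =
    A' p (0, 1, 0) ** K p + A p ** K' p (0, 1, 0) - K p ** W ** K' p (0, 1, 0)"
proof -
  have "p \<in> D" using p E_subset_D by auto
  note X_t = lyapunov_derivative_t[OF spec_A[OF \<open>p \<in> D\<close>] X'_eq[OF p] X'_eq[OF p] A_t[OF p]]
  show ?thesis
    by (rule inverse_derivative_t[OF X_K[OF p] K_X[OF p] lyap_A[OF \<open>p \<in> D\<close>] X_t K'_eq[OF p] K'_eq[OF p]])
qed

lemma K_W_K: "p \<in> E \<Longrightarrow> K p ** W ** K p = A p ** K p + K p ** dagger (A p)"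
proof -
  assume p: "p \<in> E"
  then have "p \<in> D" using E_subset_D by auto
  have "K p ** W ** K p = K p ** X p ** A p ** K p + K p ** dagger (A p) ** (X p ** K p)"
    by (simp add: lyap_A[OF \<open>p \<in> D\<close>, symmetric] matrix_mult_distribs matrix_mul_assoc)
  then show ?thesis by (simp add: K_X[OF p] X_K[OF p])
qed

abbreviation "\<psi>' p h \<equiv> J ** U0 ** K' p h ** V0"

lemma has_derivative_\<psi>: "p \<in> E \<Longrightarrow> (\<psi> has_derivative \<psi>' p) (at p)"
  unfolding \<psi>_def[abs_def]
  by (rule bounded_linear.has_derivative[OF bounded_linear_two_sided_mult has_derivative_K])

lemma smooth_\<psi>: "smooth_on E \<psi>"
  unfolding \<psi>_def[abs_def]
  by (rule smooth_on_bounded_linear[OF open_E bounded_linear_two_sided_mult smooth_K])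

lemma \<psi>_x:
  assumes p: "p \<in> E"
  shows "\<psi>' p (1, 0, 0) = (1/2) *\<^sub>R (G p - J ** G p ** J + \<psi> p ** J ** \<psi> p ** J - \<psi> p ** \<psi> p)"
proof -
  have "U0 ** (K p ** W ** K p) ** V0 = U0 ** K p ** V0 ** U0 ** K p ** V0"
    by (simp add: W_def matrix_mul_assoc)
  then have "U0 ** K p ** dagger (A p) ** V0 = U0 ** K p ** V0 ** U0 ** K p ** V0 - G p"
    by (simp add: K_W_K[OF p] G_def matrix_mult_distribs matrix_mul_assoc eq_diff_eq add.commute)
  then have "J ** (U0 ** K p ** dagger (A p) ** V0) ** J
      = J ** (U0 ** K p ** V0 ** U0 ** K p ** V0) ** J - J ** G p ** J"
    by (simp add: matrix_mult_distribs)
  moreover have "J ** (U0 ** K p ** V0 ** U0 ** K p ** V0) ** J = \<psi> p ** J ** \<psi> p ** J"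
    by (simp add: \<psi>_def matrix_mul_assoc[symmetric] J_J_mult)
  moreover have "J ** U0 ** (K p ** dagger (A p) ** JJ) ** V0 = J ** (U0 ** K p ** dagger (A p) ** V0) ** J"
    by (simp add: matrix_mul_assoc[symmetric] JJ_V0)
  moreover have "J ** U0 ** (JJ ** A p ** K p) ** V0 = G p"
  proof -
    have "J ** U0 ** JJ = U0" by (simp add: J_U0 matrix_mul_assoc[symmetric] JJ_square)
    then show ?thesis by (simp add: G_def matrix_mul_assoc)
  qed
  moreover have "J ** U0 ** (K p ** W ** JJ ** K p) ** V0 = \<psi> p ** \<psi> p"
    by (simp add: W_def \<psi>_def matrix_mul_assoc[symmetric])
      (simp add: matrix_mul_assoc J_U0)
  ultimately show ?thesis
    by (simp add: K_x[OF p] matrix_mult_distribs)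
qed

lemma has_derivative_G:
  assumes p: "p \<in> E"
  shows "(G has_derivative (\<lambda>h. U0 ** (A p ** K' p h + A' p h ** K p) ** V0)) (at p)"
proof -
  have "((\<lambda>p. U0 ** (A p ** K p) ** V0) has_derivative
      (\<lambda>h. U0 ** (A p ** K' p h + A' p h ** K p) ** V0)) (at p)"
    by (rule bounded_linear.has_derivative[OF bounded_linear_two_sided_mult
          matrix_mult.FDERIV[OF has_derivative_A[OF p] has_derivative_K[OF p]]])
  then show ?thesis by (simp add: G_def[abs_def] matrix_mul_assoc)
qed

lemma block_r_\<psi>:
  assumes p: "p \<in> E"
  shows "block_r (\<psi> p) = pm c *\<^sub>R dagger (block_q (\<psi> p))"
proof -
  have "dagger (block_r (\<psi> p)) = pm c *\<^sub>R block_q (\<psi> p)"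
  proof (cases c)
    case Defocusing
    then have "dagger (\<psi> p) = \<psi> p"
      unfolding \<psi>_def by (simp add: V0_eq dagger_mult dagger_K[OF p] matrix_mul_assoc)
    then show ?thesis by (simp add: dagger_block_r Defocusing)
  next
    case Focusing
    then have "dagger (\<psi> p) = J ** \<psi> p ** J"
      unfolding \<psi>_def by (simp add: V0_eq dagger_mult dagger_K[OF p] matrix_mul_assoc)
    then show ?thesis
      by (simp add: dagger_block_r Focusing block_mult block_J matrix_mult_distribs)
  qed
  from arg_cong[OF this, of dagger] show ?thesis by (simp add: dagger_scaleR)
qed

lemma solves_matrix_NLS_dressed:
  assumes \<phi>0: "J ** \<phi>0 = \<phi>0 ** J"
  shows "solves_matrix_NLS c E (\<lambda>p. block_u (\<phi>0 + \<psi> p)) (\<lambda>p. block_q (\<phi>0 + \<psi> p))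
    (\<lambda>p. block_v (\<phi>0 + \<psi> p))"
proof -
  let ?\<phi> = "\<lambda>p. \<phi>0 + \<psi> p"
  let ?u = "\<lambda>p. block_u (?\<phi> p)" and ?q = "\<lambda>p. block_q (?\<phi> p)" and ?v = "\<lambda>p. block_v (?\<phi> p)"
  have "block_q (J ** \<phi>0) = block_q (\<phi>0 ** J)" by (simp add: \<phi>0)
  then have "block_q \<phi>0 = 0"
    by (simp add: block_mult block_J matrix_mult_distribs vec_eq_iff)
  then have q: "block_q (?\<phi> p) = block_q (\<psi> p)" for p by (simp add: block_linear)
  have smooth_\<phi>: "smooth_on E ?\<phi>"
    using smooth_\<psi> by (simp add: smooth_on_def Ck_on_add Ck_on_const open_E)
  have \<phi>': "(?\<phi> has_derivative \<psi>' p) (at p)" if "p \<in> E" for p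
    using has_derivative_add[OF has_derivative_const has_derivative_\<psi>[OF that]] by simp
  note u' = bounded_linear.has_derivative[OF bounded_linear_block(1) \<phi>']
  note q' = bounded_linear.has_derivative[OF bounded_linear_block(2) \<phi>']
  note v' = bounded_linear.has_derivative[OF bounded_linear_block(4) \<phi>']
  have u_x: "d_x ?u p = - (pm c *\<^sub>R (?q p ** dagger (?q p)))"
    and v_x: "d_x ?v p = - (pm c *\<^sub>R (dagger (?q p) ** ?q p))"
    if p: "p \<in> E" for p
    unfolding d_x_has_derivative[OF u'[OF p]]
      d_x_has_derivative[OF v'[OF p]] block_derivative_x[OF \<psi>_x[OF p]] block_r_\<psi>[OF p] q
    by (simp_all add: matrix_mult_distribs)
  have q_x: "d_x ?q p = block_q (G p) - block_u (\<psi> p) ** block_q (\<psi> p)" if p: "p \<in> E" for p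
    unfolding d_x_has_derivative[OF q'[OF p]] by (rule block_derivative_x(2)[OF \<psi>_x[OF p]])
  have "mat (- \<i>) ** d_t ?q p = d_y (d_x ?q) p + ?q p ** d_y ?v p + d_y ?u p ** ?q p"
    if p: "p \<in> E" for p
  proof -
    let ?y = "(0, 1, 0)" and ?B = "\<lambda>M. U0 ** M ** V0"
    have "((\<lambda>p. block_q (G p) - block_u (\<psi> p) ** block_q (\<psi> p)) has_derivative
      (\<lambda>h. block_q (U0 ** (A p ** K' p h + A' p h ** K p) ** V0) - (block_u (\<psi> p) ** block_q (\<psi>' p h)
        + block_u (\<psi>' p h) ** block_q (\<psi> p)))) (at p)"
      by (rule has_derivative_diff[OF
            bounded_linear.has_derivative[OF bounded_linear_block(2) has_derivative_G[OF p]]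
            matrix_mult.FDERIV[OF
              bounded_linear.has_derivative[OF bounded_linear_block(1) has_derivative_\<psi>[OF p]]
              bounded_linear.has_derivative[OF bounded_linear_block(2) has_derivative_\<psi>[OF p]]]])
    from has_derivative_transform_within_open[OF this open_E p q_x[symmetric]]
    have q_xy: "d_y (d_x ?q) p = block_q (?B (A p ** K' p ?y + A' p ?y ** K p))
      - (block_u (\<psi> p) ** block_q (\<psi>' p ?y) + block_u (\<psi>' p ?y) ** block_q (\<psi> p))"
      by (rule d_y_has_derivative)
    have "d_y (d_x ?q) p + ?q p ** d_y ?v p + d_y ?u p ** ?q p
      = block_q (?B (A p ** K' p ?y + A' p ?y ** K p))
        - (block_u (\<psi> p) ** block_q (\<psi>' p ?y) - block_q (\<psi> p) ** block_v (\<psi>' p ?y))"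
      unfolding d_y_has_derivative[OF v'[OF p]] d_y_has_derivative[OF u'[OF p]] q_xy unfolding q by simp
    also have "block_u (\<psi> p) ** block_q (\<psi>' p ?y) - block_q (\<psi> p) ** block_v (\<psi>' p ?y)
      = block_q (J ** (\<psi> p ** (J ** \<psi>' p ?y)))"
      by (simp add: block_mult block_J matrix_mult_distribs)
    also have "J ** (\<psi> p ** (J ** \<psi>' p ?y)) = ?B (K p ** W ** K' p ?y)"
      by (simp add: \<psi>_def W_def matrix_mul_assoc[symmetric] J_J_mult)
    also have "block_q (?B (A p ** K' p ?y + A' p ?y ** K p)) - block_q (?B (K p ** W ** K' p ?y))
      = block_q (?B (mat (- \<i>) ** K' p (0, 0, 1)))"
      unfolding K_t[OF p] by (simp add: block_linear(6)[symmetric] matrix_mult_distribs add.commute)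
    also have "\<dots> = block_q (J ** (mat (- \<i>) ** \<psi>' p (0, 0, 1)))"
      by (simp add: matrix_mul_assoc[symmetric] mat_mult_left_commute J_J_mult)
    also have "\<dots> = mat (- \<i>) ** d_t ?q p"
      by (simp only: block_q_J_mult block_q_mat_mult d_t_has_derivative[OF q'[OF p]])
    finally show ?thesis by (rule sym)
  qed
  then show ?thesis
    unfolding solves_matrix_NLS_def
    using u_x v_x
      smooth_on_bounded_linear[OF open_E bounded_linear_block(1) smooth_\<phi>]
      smooth_on_bounded_linear[OF open_E bounded_linear_block(2) smooth_\<phi>]
      smooth_on_bounded_linear[OF open_E bounded_linear_block(4) smooth_\<phi>]
    by (intro conjI ballI)
qed

end

theorem corollary6p4:
  fixes c :: reduction
    and D :: "point set"
    and \<phi>0 C :: "complex ^ ('m1::finite + 'm2::finite) ^ ('m1 + 'm2)"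
    and JJ :: "complex ^ 'n ^ 'n"
    and P :: "point \<Rightarrow> complex ^ 'n ^ 'n"
    and U0 :: "complex ^ 'n ^ ('m1 + 'm2)"
    and V0 :: "complex ^ ('m1 + 'm2) ^ 'n"
  assumes "open D"
    and "J ** \<phi>0 = \<phi>0 ** J"
    and "dagger C = - C" and "C ** J = J ** C"
    and "reduction_condition c \<phi>0 C"
    and "diagonal_signs JJ"
    and "smooth_on D P"
    and "\<And>p. p \<in> D \<Longrightarrow> mat \<i> ** d_t P p + d_y P p ** JJ ** P p = 0"
    and "\<And>p. p \<in> D \<Longrightarrow> d_x P p = (1/2) *\<^sub>R ((JJ ** P p ** JJ - P p) ** P p)"
    and "\<And>p. p \<in> D \<Longrightarrow> spectrum (JJ ** P p) \<inter> spectrum (- (dagger (P p) ** JJ)) = {}"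
    and "J ** U0 = U0 ** JJ"
    and "V0 = V0_of c U0"
  shows "(\<forall>p\<in>D. \<exists>!Y. lyapunov (JJ ** P p) (V0 ** U0) Y) \<and>
    (\<forall>X. (\<forall>p\<in>D. lyapunov (JJ ** P p) (V0 ** U0) (X p)) \<longrightarrow>
      (let \<phi> = (\<lambda>p. \<phi>0 + J ** U0 ** matrix_inv (X p) ** V0);
           u = (\<lambda>p. block_u (\<phi> p));
           q = (\<lambda>p. block_q (\<phi> p));
           v = (\<lambda>p. block_v (\<phi> p));
           E = {p \<in> D. invertible (X p)}
       in solves_matrix_NLS c E u q v \<and>
          (CARD('m1) = 1 \<and> CARD('m2) = 1 \<longrightarrow>
             (\<forall>a b. solves_scalar_NLS c E (\<lambda>p. q p $ a $ b)
                (\<lambda>p. - of_real (pm c / 2) * (u p $ a $ a + v p $ b $ b))))))"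
proof (intro conjI ballI allI impI)
  fix p assume "p \<in> D"
  have "dagger JJ = JJ" by (rule diagonal_signs_dagger[OF assms(6)])
  then show "\<exists>!Y. lyapunov (JJ ** P p) (V0 ** U0) Y"
    using assms(10)[OF \<open>p \<in> D\<close>] by (intro lyapunov_ex1) (simp add: dagger_mult)
next
  fix X assume X: "\<forall>p\<in>D. lyapunov (JJ ** P p) (V0 ** U0) (X p)"
  interpret lyapunov_solution c D JJ P X U0 V0
    using assms X by unfold_locales auto
  note sol = solves_matrix_NLS_dressed[OF assms(2), unfolded \<psi>_def K_def E_def]
  show "let \<phi> = (\<lambda>p. \<phi>0 + J ** U0 ** matrix_inv (X p) ** V0);
           u = (\<lambda>p. block_u (\<phi> p));
           q = (\<lambda>p. block_q (\<phi> p));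
           v = (\<lambda>p. block_v (\<phi> p));
           E = {p \<in> D. invertible (X p)}
       in solves_matrix_NLS c E u q v \<and>
          (CARD('m1) = 1 \<and> CARD('m2) = 1 \<longrightarrow>
             (\<forall>a b. solves_scalar_NLS c E (\<lambda>p. q p $ a $ b)
                (\<lambda>p. - of_real (pm c / 2) * (u p $ a $ a + v p $ b $ b))))"
    unfolding Let_def
    using sol solves_scalar_NLS_of_matrix_NLS[OF open_E[unfolded E_def] sol] by blast
qed

end
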